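(* Let $n\ge1$ and let $C_n^{\mathrm{geo}}$ be the set of $n$ equidistant points on the circle of total arclength $2\pi$ with the geodesic (arclength) metric. Then for $t\in(0,\infty)$ $$|tC_n^{\mathrm{geo}}|_{\mathrm{Rips}}=\sum_{\substack{r\mid n,\ r\text{ odd}\\ r\neq n}}\frac nr\bigl(e^{-\eta_rt}-e^{-\eta_{r,n}t}\bigr)+e^{-\eta_nt},$$ where the sum is over positive odd divisors $r\neq n$ of $n$ and $$\eta_r=2\pi\frac{\lfloor r/2\rfloor}{r},\qquad \eta_{r,n}=2\pi\left(\frac1n+\frac{\lfloor r/2\rfloor}{r}\right).$$
   Context: For a finite metric space $X$, the Rips magnitude function $|tX|_{\mathrm{Rips}}$ is the persistent magnitude function of the persistent homology of its Vietoris–Rips complex; equivalently, it is given for $t\in(0,\infty)$ by $|tX|_{\mathrm{Rips}}=\sum_{\emptyset\ne A\subseteq X}(-1)^{\#A-1}e^{-\mathrm{diam}(A)t}$. *)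

theory Defs
  imports "HOL-Analysis.Analysis"
begin

definition rips_complex :: "'a set \<Rightarrow> ('a \<Rightarrow> 'a \<Rightarrow> real) \<Rightarrow> real \<Rightarrow> 'a set set" where
  "rips_complex X d r = {A. A \<noteq> {} \<and> A \<subseteq> X \<and> (\<forall>x\<in>A. \<forall>y\<in>A. d x y \<le> r)}"

text \<open>
  Simplicial chains of a complex \<open>K\<close> on a finite vertex set \<open>X\<close> with coefficients in a field \<open>'k\<close>:
  a chain is its coefficient function, and every simplex is oriented by the linear order on the
  vertices. For \<open>A = {x\<^sub>0 < \<dots> < x\<^sub>k}\<close> the usual formula
  \<open>\<partial>A = (\<Sum>i\<le>k. (-1)^i * (A - {x\<^sub>i}))\<close> says that the coefficient of \<open>\<partial>c\<close> at a nonempty \<open>A\<close> is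
  the signed sum of the coefficients of \<open>c\<close> at the simplices \<open>insert v A\<close>.
  The value at \<open>{}\<close> is \<open>0\<close>: homology is not reduced.
\<close>

definition simplicial_chains :: "'a set set \<Rightarrow> nat \<Rightarrow> ('a set \<Rightarrow> 'k::field) set" where
  "simplicial_chains K k = {c. \<forall>A. c A \<noteq> 0 \<longrightarrow> A \<in> K \<and> card A = Suc k}"

definition boundary_map :: "'a::linorder set \<Rightarrow> ('a set \<Rightarrow> 'k::field) \<Rightarrow> 'a set \<Rightarrow> 'k" where
  "boundary_map X c A =
    (if A = {} then 0 else (\<Sum>v\<in>X - A. (-1) ^ card {u\<in>A. u < v} * c (insert v A)))"

definition cycles :: "'a::linorder set \<Rightarrow> 'a set set \<Rightarrow> nat \<Rightarrow> ('a set \<Rightarrow> 'k::field) set" where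
  "cycles X K k = {c \<in> simplicial_chains K k. boundary_map X c = (\<lambda>_. 0)}"

definition boundaries :: "'a::linorder set \<Rightarrow> 'a set set \<Rightarrow> nat \<Rightarrow> ('a set \<Rightarrow> 'k::field) set" where
  "boundaries X K k = boundary_map X ` simplicial_chains K (Suc k)"

text \<open>
  A persistence module is given here as \<open>M r = Z r / B r\<close>, where \<open>Z r\<close> and \<open>B r \<subseteq> Z r\<close> are increasing
  families of subspaces of a space of functions and the structure maps are induced by inclusion.
  A homomorphism from the interval module on \<open>[a, b)\<close> to \<open>M\<close> is a class in \<open>M a\<close> that vanishes in
  \<open>M r\<close> for all \<open>r \<ge> b\<close>. The predicate below says that the homomorphisms given by the classes of
  \<open>g i\<close>, \<open>i \<in> I\<close>, form an isomorphism from the finite direct sum of the interval modules on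
  \<open>[a i, b i)\<close> to \<open>M\<close>: for every \<open>r\<close>, the classes of those \<open>g i\<close> with \<open>r \<in> [a i, b i)\<close>
  are a basis of \<open>M r\<close>.
\<close>

definition interval_decomposition ::
  "(real \<Rightarrow> ('s \<Rightarrow> 'k::field) set) \<Rightarrow> (real \<Rightarrow> ('s \<Rightarrow> 'k) set)
    \<Rightarrow> nat set \<Rightarrow> (nat \<Rightarrow> real) \<Rightarrow> (nat \<Rightarrow> ereal) \<Rightarrow> (nat \<Rightarrow> 's \<Rightarrow> 'k) \<Rightarrow> bool" where
  "interval_decomposition Z B I a b g \<longleftrightarrow>
    finite I \<and>
    (\<forall>i\<in>I. ereal (a i) < b i \<and> g i \<in> Z (a i) \<and> (\<forall>r. b i \<le> ereal r \<longrightarrow> g i \<in> B r)) \<and>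
    (\<forall>r. \<forall>z\<in>Z r. \<exists>!c. (\<forall>i. i \<notin> {i\<in>I. a i \<le> r \<and> ereal r < b i} \<longrightarrow> c i = 0) \<and>
      (\<lambda>s. z s - (\<Sum>i\<in>{i\<in>I. a i \<le> r \<and> ereal r < b i}. c i * g i s)) \<in> B r)"

text \<open>The convention is \<open>exp (-\<infinity>) = 0\<close>; it is used for \<open>t > 0\<close> only.\<close>

definition bar_magnitude :: "real \<Rightarrow> real \<Rightarrow> ereal \<Rightarrow> real" where
  "bar_magnitude t a b = exp (- a * t) - (if b = \<infinity> then 0 else exp (- real_of_ereal b * t))"

definition persistent_magnitude ::
  "(real \<Rightarrow> ('s \<Rightarrow> 'k::field) set) \<Rightarrow> (real \<Rightarrow> ('s \<Rightarrow> 'k) set) \<Rightarrow> real \<Rightarrow> real" where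
  "persistent_magnitude Z B t =
    (THE m. \<exists>I a b g. interval_decomposition Z B I a b g \<and> m = (\<Sum>i\<in>I. bar_magnitude t (a i) (b i)))"

text \<open>
  The graded persistent magnitude of the persistent homology of the Vietoris--Rips filtration over
  the field \<open>'k\<close>. Simplices on \<open>X\<close> have dimension less than \<open>card X\<close>.
\<close>

definition rips_magnitude ::
  "'k::field itself \<Rightarrow> 'a::linorder set \<Rightarrow> ('a \<Rightarrow> 'a \<Rightarrow> real) \<Rightarrow> real \<Rightarrow> real" where
  "rips_magnitude _ X d t =
    (\<Sum>k<card X. (-1) ^ k *
      persistent_magnitude
        (\<lambda>r. cycles X (rips_complex X d r) k :: ('a set \<Rightarrow> 'k) set)
        (\<lambda>r. boundaries X (rips_complex X d r) k) t)"

text \<open>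
  The circle of total arclength \<open>2 * pi\<close> is represented by its arclength parameter in
  \<open>[0, 2 * pi)\<close>; the geodesic distance of two points is the length of the shorter arc.
\<close>

definition geodesic_dist :: "real \<Rightarrow> real \<Rightarrow> real" where
  "geodesic_dist x y = min \<bar>x - y\<bar> (2 * pi - \<bar>x - y\<bar>)"

definition C_geo :: "nat \<Rightarrow> real set" where
  "C_geo n = (\<lambda>j. 2 * pi * real j / real n) ` {..<n}"

definition eta :: "nat \<Rightarrow> real" where
  "eta r = 2 * pi * (of_int \<lfloor>real r / 2\<rfloor> / real r)"

definition eta2 :: "nat \<Rightarrow> nat \<Rightarrow> real" where
  "eta2 r n = 2 * pi * (1 / real n + of_int \<lfloor>real r / 2\<rfloor> / real r)"

text \<open>
  The rest of the theory shows that the definitions are meaningful; the results are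
  \<open>rips_magnitude_eq\<close> and \<open>C_geo_metric\<close>. Interval decompositions are obtained by adding the
  simplices one at a time: \<open>filt_ex\<close> pairs each simplex that kills a class with the one creating it.
  The magnitude does not depend on the decomposition, because the number of bars alive at \<open>r\<close> is the
  dimension of \<open>M r\<close>.
\<close>

definition lin :: "('s \<Rightarrow> 'k::field) set \<Rightarrow> bool" where
  "lin S \<longleftrightarrow> (\<lambda>_. 0) \<in> S \<and> (\<forall>f\<in>S. \<forall>g\<in>S. \<forall>a b. (\<lambda>s. a * f s + b * g s) \<in> S)"

lemma lin0: "lin S \<Longrightarrow> (\<lambda>_. 0) \<in> S" by (simp add: lin_def)
lemma linc: "lin S \<Longrightarrow> f \<in> S \<Longrightarrow> g \<in> S \<Longrightarrow> (\<lambda>s. a * f s + b * g s) \<in> S" by (simp add: lin_def)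
lemma lin_scale: "lin S \<Longrightarrow> f \<in> S \<Longrightarrow> (\<lambda>s. a * f s) \<in> S" 
  using linc[of S f f a 0] by simp
lemma lin_diff: "lin S \<Longrightarrow> f \<in> S \<Longrightarrow> g \<in> S \<Longrightarrow> (\<lambda>s. f s - g s) \<in> S" 
  using linc[of S f g 1 "-1"] by simp
lemma lin_add: "lin S \<Longrightarrow> f \<in> S \<Longrightarrow> g \<in> S \<Longrightarrow> (\<lambda>s. f s + g s) \<in> S" 
  using linc[of S f g 1 1] by simp
lemma lin_sum: "lin S \<Longrightarrow> finite I \<Longrightarrow> (\<And>i. i \<in> I \<Longrightarrow> f i \<in> S) \<Longrightarrow> (\<lambda>s. \<Sum>i\<in>I. c i * f i s) \<in> S"
proof (induction I rule: infinite_finite_induct)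
  case (insert x F)
  have "(\<lambda>s. c x * f x s + (\<Sum>i\<in>F. c i * f i s)) \<in> S"
    by (rule lin_add) (use insert in \<open>auto intro: lin_scale\<close>)
  then show ?case using insert by simp
qed (auto intro: lin0)

definition LC :: "'i set \<Rightarrow> ('i \<Rightarrow> 's \<Rightarrow> 'k::field) \<Rightarrow> ('s \<Rightarrow> 'k) set" where
  "LC S z = range (\<lambda>c s. \<Sum>j\<in>S. c j * z j s)"

lemma LC_I: "(\<lambda>s. \<Sum>j\<in>S. c j * z j s) \<in> LC S z" unfolding LC_def by blast
lemma LC_E: "f \<in> LC S z \<Longrightarrow> \<exists>c. f = (\<lambda>s. \<Sum>j\<in>S. c j * z j s)" unfolding LC_def by blast

lemma LC_lin: "lin (LC S z)"
  unfolding lin_def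
proof (intro conjI ballI allI)
  show "(\<lambda>_. 0) \<in> LC S z" using LC_I[where c="\<lambda>_. 0"] by simp
next
  fix f g a b assume "f \<in> LC S z" "g \<in> LC S z"
  from LC_E[OF this(1)] LC_E[OF this(2)] obtain c d where
    "f = (\<lambda>s. \<Sum>j\<in>S. c j * z j s)" "g = (\<lambda>s. \<Sum>j\<in>S. d j * z j s)" by (elim exE)
  then have "(\<lambda>s. a * f s + b * g s) = (\<lambda>s. \<Sum>j\<in>S. (a * c j + b * d j) * z j s)"
    by (simp add: sum_distrib_left sum.distrib algebra_simps)
  then show "(\<lambda>s. a * f s + b * g s) \<in> LC S z" by (simp only: LC_I)
qed

lemma LC_base: assumes "finite S" "j \<in> S" shows "z j \<in> LC S z"
proof -
  have "z j = (\<lambda>s. \<Sum>i\<in>S. (if i = j then 1 else 0) * z i s)" 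
    using assms by (simp add: if_distrib[of "\<lambda>x. x * _"] cong: if_cong)
  then show ?thesis using LC_I[where S=S and z=z and c="\<lambda>i. if i = j then 1 else 0"] by simp
qed

lemma LC_least: "finite S \<Longrightarrow> lin V \<Longrightarrow> (\<And>j. j \<in> S \<Longrightarrow> z j \<in> V) \<Longrightarrow> LC S z \<subseteq> V"
  unfolding LC_def by (auto intro: lin_sum)

lemma LC_cong: "(\<And>j. j \<in> S \<Longrightarrow> z j = z' j) \<Longrightarrow> LC S z = LC S z'"
  unfolding LC_def by (intro arg_cong[of _ _ range] ext sum.cong) auto

lemma chains_lin: "lin (simplicial_chains K k)"
  unfolding lin_def simplicial_chains_def
proof (intro conjI ballI allI CollectI impI, goal_cases)
  case (4 f g a b A) then have "f A \<noteq> 0 \<or> g A \<noteq> 0" by auto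
  then show ?case using 4 by blast
next
  case (3 f g a b A) then have "f A \<noteq> 0 \<or> g A \<noteq> 0" by auto
  then show ?case using 3 by blast
qed auto

lemma bd_lin: "boundary_map X (\<lambda>s. a * f s + b * g s) = (\<lambda>A. a * boundary_map X f A + b * boundary_map X g A)"
  by (rule ext) (simp add: boundary_map_def sum_distrib_left sum.distrib algebra_simps)

lemma bd0: "boundary_map X (\<lambda>_. 0) = (\<lambda>_. 0)"
  by (rule ext) (simp add: boundary_map_def)

lemma cycles_lin: "lin (cycles X K k)"
  using chains_lin[of K k] unfolding lin_def cycles_def by (auto simp add: bd_lin bd0)

lemma boundaries_lin: "lin (boundaries X K k :: ('a::linorder set \<Rightarrow> 'k::field) set)"
  unfolding lin_def
proof (intro conjI ballI allI)
  show "(\<lambda>_. 0) \<in> boundaries X K k"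
    unfolding boundaries_def by (rule image_eqI[OF _ lin0[OF chains_lin]]) (simp add: bd0)
next
  fix f g :: "'a set \<Rightarrow> 'k" and a b assume "f \<in> boundaries X K k" "g \<in> boundaries X K k"
  then obtain f' g' where *: "f = boundary_map X f'" "f' \<in> simplicial_chains K (Suc k)"
      "g = boundary_map X g'" "g' \<in> simplicial_chains K (Suc k)"
    unfolding boundaries_def by (elim imageE)
  show "(\<lambda>s. a * f s + b * g s) \<in> boundaries X K k" unfolding boundaries_def
    by (rule image_eqI[OF _ linc[OF chains_lin *(2) *(4), of a b]]) (simp add: bd_lin *)
qed

lemma bd_bd:
  assumes X: "finite (X::'a::linorder set)" and c: "\<And>A. c A \<noteq> (0::'k::field) \<Longrightarrow> finite A"
  shows "boundary_map X (boundary_map X c) = (\<lambda>_. 0)"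
proof
  fix A :: "'a set"
  consider "A = {}" | "infinite A" | "A \<noteq> {}" "finite A" by blast
  then show "boundary_map X (boundary_map X c) A = 0"
  proof cases
    case 1 then show ?thesis by (simp add: boundary_map_def)
  next
    case 2 
    then have "c (insert w (insert v A)) = 0" for v w using c by (metis finite_insert)
    then show ?thesis by (simp add: boundary_map_def)
  next
    case 3
    define sg :: "'a \<Rightarrow> 'k" where "sg v = (-1) ^ card {u\<in>A. u < v}" for v
    define T where "T v w = sg v * sg w * c (insert v (insert w A))" for v w
    let ?Y = "X - A"
    have ins: "insert w (insert v A) = insert v (insert w A)" for v w by blast
    have s2: "(-1::'k) ^ card {u\<in>insert v A. u < w} = (if v < w then - sg w else sg w)" if "v \<in> ?Y" for v w
    proof (cases "v < w")
      case True
      then have "{u\<in>insert v A. u < w} = insert v {u\<in>A. u < w}" by auto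
      then show ?thesis using True that 3 by (simp add: sg_def)
    next
      case False
      then have "{u\<in>insert v A. u < w} = {u\<in>A. u < w}" by auto
      then show ?thesis using False by (simp add: sg_def)
    qed
    have "boundary_map X (boundary_map X c) A =
      (\<Sum>v\<in>?Y. sg v * (\<Sum>w\<in>X - insert v A. (-1) ^ card {u\<in>insert v A. u < w} * c (insert w (insert v A))))"
      using 3 by (simp add: boundary_map_def sg_def)
    also have "\<dots> = (\<Sum>v\<in>?Y. \<Sum>w\<in>?Y. if v < w then - T v w else if w < v then T v w else 0)"
    proof (intro sum.cong refl)
      fix v assume v: "v \<in> ?Y"
      have "sg v * (\<Sum>w\<in>X - insert v A. (-1) ^ card {u\<in>insert v A. u < w} * c (insert w (insert v A)))
        = (\<Sum>w\<in>X - insert v A. if v < w then - T v w else if w < v then T v w else 0)"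
        unfolding sum_distrib_left
      proof (intro sum.cong refl)
        fix w assume "w \<in> X - insert v A"
        then have "w \<noteq> v" by auto
        then consider "v < w" | "w < v" by fastforce
        then show "sg v * ((-1) ^ card {u\<in>insert v A. u < w} * c (insert w (insert v A))) = 
          (if v < w then - T v w else if w < v then T v w else 0)"
          by cases (use s2[OF v, of w] in \<open>simp_all add: T_def ins mult.assoc\<close>)
      qed
      also have "\<dots> = (\<Sum>w\<in>?Y. if v < w then - T v w else if w < v then T v w else 0)"
        by (rule sum.mono_neutral_left) (use X in auto)
      finally show "sg v * (\<Sum>w\<in>X - insert v A. (-1) ^ card {u\<in>insert v A. u < w} * c (insert w (insert v A))) = \<dots>" .
    qed
    also have "\<dots> = (\<Sum>v\<in>?Y. \<Sum>w\<in>?Y. if v < w then - T v w else 0) + (\<Sum>v\<in>?Y. \<Sum>w\<in>?Y. if w < v then T v w else 0)"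
      unfolding sum.distrib[symmetric] by (intro sum.cong refl) auto
    also have "(\<Sum>v\<in>?Y. \<Sum>w\<in>?Y. if w < v then T v w else 0) = (\<Sum>v\<in>?Y. \<Sum>w\<in>?Y. if v < w then T v w else 0)"
      by (subst sum.swap) (intro sum.cong refl, simp add: T_def ins mult_ac)
    also have "(\<Sum>v\<in>?Y. \<Sum>w\<in>?Y. if v < w then - T v w else 0) + \<dots> = 0"
      unfolding sum.distrib[symmetric] by (intro sum.neutral ballI) auto
    finally show ?thesis .
  qed
qed

lemma bd_chains:
  assumes "c \<in> simplicial_chains K (Suc k)" "\<And>A. A \<in> K \<Longrightarrow> finite A" "\<And>A B. B \<in> K \<Longrightarrow> A \<subset> B \<Longrightarrow> A \<noteq> {} \<Longrightarrow> A \<in> L"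
  shows "boundary_map X c \<in> simplicial_chains L k"
  unfolding simplicial_chains_def
proof (intro CollectI allI impI)
  fix A assume A: "boundary_map X c A \<noteq> 0"
  then have "A \<noteq> {}" by (auto simp: boundary_map_def)
  then have "\<exists>v\<in>X-A. c (insert v A) \<noteq> 0" using A unfolding boundary_map_def
    by (metis (no_types, lifting) mult_zero_right sum.neutral)
  then obtain v where v: "v \<notin> A" "c (insert v A) \<noteq> 0" by blast
  then have "insert v A \<in> K" "card (insert v A) = Suc (Suc k)" using assms(1) unfolding simplicial_chains_def by blast+
  moreover have "finite A" using assms(2) calculation(1) by (metis finite_insert)
  moreover have "A \<subset> insert v A" using v by auto
  ultimately show "A \<in> L \<and> card A = Suc k" using v assms(3) \<open>A \<noteq> {}\<close> by auto
qed

lemma bd_deg0: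
  assumes "c \<in> simplicial_chains K 0" "\<And>A. A \<in> K \<Longrightarrow> finite A"
  shows "boundary_map X c = (\<lambda>_. 0)"
proof
  fix A show "boundary_map X c A = 0"
  proof (cases "A = {}")
    case False
    have "c (insert v A) = 0" if "v \<notin> A" for v
    proof (rule ccontr)
      assume "c (insert v A) \<noteq> 0"
      then have "insert v A \<in> K" "card (insert v A) = 1" using assms(1) unfolding simplicial_chains_def by force+
      moreover have "finite A" using assms(2)[OF calculation(1)] by simp
      ultimately show False using that False by simp
    qed
    then show ?thesis by (simp add: boundary_map_def)
  qed (simp add: boundary_map_def)
qed

lemma filt_ex:
  fixes \<sigma> :: "nat \<Rightarrow> 'a::linorder set"
  assumes "finite X" "inj_on \<sigma> {..<m}" "\<forall>j<m. \<sigma> j \<noteq> {} \<and> \<sigma> j \<subseteq> X" 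
    "\<forall>j<m. \<forall>\<tau>. \<tau> \<noteq> {} \<longrightarrow> \<tau> \<subset> \<sigma> j \<longrightarrow> \<tau> \<in> \<sigma> ` {..<j}"
  shows "\<exists>P D e (z::nat\<Rightarrow>'a set\<Rightarrow>'k::field). P \<subseteq> {..<m} \<and> D \<subseteq> P \<and> bij_betw e D ({..<m} - P) \<and>
    (\<forall>j\<in>D. j < e j \<and> card (\<sigma> (e j)) = Suc (card (\<sigma> j))) \<and>
    (\<forall>j\<in>P. z j (\<sigma> j) \<noteq> 0 \<and> z j \<in> cycles X (\<sigma> ` {..<Suc j}) (card (\<sigma> j) - 1)) \<and>
    (\<forall>i\<le>m. \<forall>k. cycles X (\<sigma> ` {..<i}) k = LC {j\<in>P. j < i \<and> card (\<sigma> j) = Suc k} z) \<and>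
    (\<forall>i\<le>m. \<forall>k. boundaries X (\<sigma> ` {..<i}) k = LC {j\<in>D. e j < i \<and> card (\<sigma> j) = Suc k} z)"
  using assms(2-4)
proof (induction m)
  case 0
  have "simplicial_chains ({}::'a set set) k = {\<lambda>_. 0::'k}" for k by (auto simp: simplicial_chains_def)
  then have "cycles X {} k = {\<lambda>_. 0::'k}" "boundaries X {} k = {\<lambda>_. 0::'k}" for k 
    by (auto simp add: cycles_def boundaries_def bd0)
  moreover have "LC {} z = {\<lambda>_. 0::'k}" for z :: "nat \<Rightarrow> 'a set \<Rightarrow> 'k" by (auto simp: LC_def)
  ultimately show ?case by (intro exI[of _ "{}"] exI[of _ id] exI[of _ "\<lambda>_ _. 0"]) (auto simp: bij_betw_def)
next
  case (Suc m)
  have inj: "inj_on \<sigma> {..<m}" using Suc.prems(1) by (rule inj_on_subset) auto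
  obtain P D e and z :: "nat\<Rightarrow>'a set\<Rightarrow>'k" where
    P: "P \<subseteq> {..<m}" and D: "D \<subseteq> P" and e: "bij_betw e D ({..<m} - P)" and
    de: "\<And>j. j \<in> D \<Longrightarrow> j < e j \<and> card (\<sigma> (e j)) = Suc (card (\<sigma> j))" and
    z: "\<And>j. j \<in> P \<Longrightarrow> z j (\<sigma> j) \<noteq> 0 \<and> z j \<in> cycles X (\<sigma> ` {..<Suc j}) (card (\<sigma> j) - 1)" and
    cyc: "\<And>i k. i \<le> m \<Longrightarrow> cycles X (\<sigma> ` {..<i}) k = LC {j\<in>P. j < i \<and> card (\<sigma> j) = Suc k} z" and
    bou: "\<And>i k. i \<le> m \<Longrightarrow> boundaries X (\<sigma> ` {..<i}) k = LC {j\<in>D. e j < i \<and> card (\<sigma> j) = Suc k} z"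
  proof -
    have "\<forall>j<m. \<sigma> j \<noteq> {} \<and> \<sigma> j \<subseteq> X" "\<forall>j<m. \<forall>\<tau>. \<tau> \<noteq> {} \<longrightarrow> \<tau> \<subset> \<sigma> j \<longrightarrow> \<tau> \<in> \<sigma> ` {..<j}"
      using Suc.prems(2,3) by simp_all
    from Suc.IH[OF inj this] obtain P D e and z :: "nat\<Rightarrow>'a set\<Rightarrow>'k" where
      "P \<subseteq> {..<m} \<and> D \<subseteq> P \<and> bij_betw e D ({..<m} - P) \<and>
    (\<forall>j\<in>D. j < e j \<and> card (\<sigma> (e j)) = Suc (card (\<sigma> j))) \<and>
    (\<forall>j\<in>P. z j (\<sigma> j) \<noteq> 0 \<and> z j \<in> cycles X (\<sigma> ` {..<Suc j}) (card (\<sigma> j) - 1)) \<and>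
    (\<forall>i\<le>m. \<forall>k. cycles X (\<sigma> ` {..<i}) k = LC {j\<in>P. j < i \<and> card (\<sigma> j) = Suc k} z) \<and>
    (\<forall>i\<le>m. \<forall>k. boundaries X (\<sigma> ` {..<i}) k = LC {j\<in>D. e j < i \<and> card (\<sigma> j) = Suc k} z)"
      by (elim exE)
    then show thesis by (intro that[of P D e z]) blast+
  qed
  have em: "e j < m" if "j \<in> D" for j using e that by (auto simp: bij_betw_def)
  have Pm: "j < m" if "j \<in> P" for j using P that by auto
  have finP: "finite P" using P by (rule finite_subset) simp
  define K where "K = \<sigma> ` {..<m}"
  define s where "s = \<sigma> m"
  have img: "\<sigma> ` {..<Suc m} = insert s K" by (auto simp: K_def s_def less_Suc_eq)
  have sK: "s \<notin> K" 
  proof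
    assume "s \<in> K"
    then obtain j where "j < m" "\<sigma> j = \<sigma> m" by (auto simp: K_def s_def)
    then show False using inj_onD[OF Suc.prems(1), of j m] by simp
  qed
  have s: "s \<noteq> {}" "s \<subseteq> X" using Suc.prems(2) by (auto simp: s_def)
  have fs: "finite s" using s(2) assms(1) by (rule finite_subset)
  have fK: "finite A" if "A \<in> insert s K" for A
  proof -
    have "\<sigma> j \<subseteq> X" if "j < m" for j using Suc.prems(2) that by simp
    then have "A \<subseteq> X" using that s(2) unfolding K_def by blast
    then show ?thesis using assms(1) finite_subset by metis
  qed
  have "card s \<noteq> 0" using s(1) fs by simp
  then obtain k0 where k0: "card s = Suc k0" using not0_implies_Suc by blast
  define es :: "'a set \<Rightarrow> 'k" where "es = (\<lambda>A. if A = s then 1 else 0)"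
  have es: "es \<in> simplicial_chains (insert s K) k0" by (auto simp: simplicial_chains_def es_def k0 split: if_splits)
  have esS: "es \<in> simplicial_chains {s} k0" by (auto simp: simplicial_chains_def es_def k0 split: if_splits)
  have mono: "(simplicial_chains K k :: ('a set \<Rightarrow> 'k) set) \<subseteq> simplicial_chains (insert s K) k" for k by (auto simp: simplicial_chains_def)
  have chk: "(simplicial_chains (insert s K) k :: ('a set \<Rightarrow> 'k) set) = simplicial_chains K k" if "k \<noteq> k0" for k
    using that k0 by (auto simp: simplicial_chains_def)
  have dec: "(\<lambda>A. w A - w s * es A) \<in> simplicial_chains K k0" if "w \<in> simplicial_chains (insert s K) k0" for w
    using that by (auto simp: simplicial_chains_def es_def)
  have bdd: "boundary_map X (\<lambda>A. f A - a * g A) = (\<lambda>A. boundary_map X f A - a * boundary_map X g A)" for f g :: "'a set \<Rightarrow> 'k" and a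
    using bd_lin[of X 1 f "-a" g] by simp
  have bdec: "boundary_map X w = (\<lambda>A. w s * boundary_map X es A + boundary_map X (\<lambda>A. w A - w s * es A) A)" for w
    unfolding bdd by simp
  have bdch: "boundary_map X es \<in> simplicial_chains K k" if "k0 = Suc k" for k
  proof (rule bd_chains[where K="{s}"])
    show "es \<in> simplicial_chains {s} (Suc k)" using esS that by auto
    show "finite A" if "A \<in> {s}" for A using that fs by simp
    show "A \<in> K" if "B \<in> {s}" "A \<subset> B" "A \<noteq> {}" for A B using that Suc.prems(3) by (auto simp: s_def K_def)
  qed
  have bdcy: "boundary_map X es \<in> cycles X K k" if "k0 = Suc k" for k
  proof -
    have "finite A" if "es A \<noteq> 0" for A using that fs by (simp add: es_def split: if_splits)
    from bd_bd[OF assms(1) this] show ?thesis unfolding cycles_def using bdch[OF that] by blast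
  qed
  show ?case
  proof (cases "\<exists>c\<in>simplicial_chains K k0. boundary_map X c = boundary_map X es")
    case True
    then obtain c where c: "c \<in> simplicial_chains K k0" "boundary_map X c = boundary_map X es" by blast
    define z' where "z' = z(m := (\<lambda>A. es A - c A))"
    define P' where "P' = insert m P"
    have z'm: "z' m = (\<lambda>A. es A - 1 * c A)" by (simp add: z'_def)
    have z'j: "z' j = z j" if "j \<in> P" for j using that P by (auto simp: z'_def)
    have zP: "LC {j\<in>P. Q j} z' = LC {j\<in>P. Q j} z" "LC {j\<in>D. Q j} z' = LC {j\<in>D. Q j} z" for Q
      by (rule LC_cong; use z'j D in blast)+
    have cs: "c s = 0" using c sK by (auto simp: simplicial_chains_def)
    have zc: "z' m \<in> cycles X (insert s K) k0"
    proof -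
      have "boundary_map X (z' m) = (\<lambda>_. 0)" unfolding z'm bdd c(2) by simp
      moreover have "z' m \<in> simplicial_chains (insert s K) k0" 
        unfolding z'm using linc[OF chains_lin es, of c 1 "-1"] c(1) mono[of k0] by auto
      ultimately show ?thesis by (simp add: cycles_def)
    qed
    have "cycles X (\<sigma> ` {..<i}) k = LC {j\<in>P'. j < i \<and> card (\<sigma> j) = Suc k} z'" if i: "i \<le> Suc m" for i k
    proof (cases "i = Suc m")
      case False
      then have "{j\<in>P'. j < i \<and> card (\<sigma> j) = Suc k} = {j\<in>P. j < i \<and> card (\<sigma> j) = Suc k}"
        using i by (auto simp: P'_def)
      then show ?thesis using cyc[of i k] False i by (simp add: zP)
    next
      case im: True
      show ?thesis
      proof (cases "k = k0")
        case False
        then have "{j\<in>P'. j < i \<and> card (\<sigma> j) = Suc k} = {j\<in>P. j < m \<and> card (\<sigma> j) = Suc k}"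
          using im k0 False by (auto simp: P'_def s_def dest: Pm)
        moreover have "(cycles X (insert s K) k :: ('a set \<Rightarrow> 'k) set) = cycles X K k" using chk[OF False] by (simp add: cycles_def)
        ultimately show ?thesis using cyc[of m k] unfolding im img K_def by (simp add: zP)
      next
        case True
        let ?S = "{j\<in>P'. j < i \<and> card (\<sigma> j) = Suc k}" and ?T = "{j\<in>P. j < m \<and> card (\<sigma> j) = Suc k}"
        have cm: "card (\<sigma> m) = Suc k" using k0 True by (simp add: s_def)
        have S: "?S = insert m ?T"
        proof (rule set_eqI)
          fix x show "x \<in> ?S \<longleftrightarrow> x \<in> insert m ?T"
            using im cm Pm[of x] by (cases "x = m") (simp_all add: P'_def, blast intro: less_SucI)
        qed
        have fS: "finite ?S" using finP by (simp add: P'_def)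
        have cK: "cycles X K k = LC ?T z'" unfolding K_def using cyc[of m k] by (simp add: zP)
        have "cycles X (insert s K) k = LC ?S z'"
        proof
          show "LC ?S z' \<subseteq> cycles X (insert s K) k"
          proof (rule LC_least[OF fS cycles_lin])
            fix j assume "j \<in> ?S"
            then consider "j = m" | "j \<in> ?T" using S by auto
            then show "z' j \<in> cycles X (insert s K) k"
            proof cases
              case 1 then show ?thesis using zc True by simp
            next
              case 2
              then have "z' j \<in> LC ?T z'" using finP by (intro LC_base) auto
              then show ?thesis using cK mono[of k] by (auto simp: cycles_def)
            qed
          qed
          show "cycles X (insert s K) k \<subseteq> LC ?S z'"
          proof
            fix w :: "'a set \<Rightarrow> 'k" assume w: "w \<in> cycles X (insert s K) k"
            have zm: "z' m \<in> LC ?S z'" using S fS by (intro LC_base) auto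
            let ?w = "\<lambda>A. w A - w s * z' m A"
            have "?w \<in> cycles X (insert s K) k"
              using linc[OF cycles_lin w, of "z' m" 1 "- w s"] zc True by simp
            moreover have "?w s = 0" using cs by (simp add: z'm es_def)
            ultimately have "?w \<in> cycles X K k" by (auto simp: cycles_def simplicial_chains_def)
            then have "?w \<in> LC ?T z'" using cK by simp
            moreover have "LC ?T z' \<subseteq> LC ?S z'"
              using finP fS S by (intro LC_least LC_lin LC_base) auto
            ultimately have "?w \<in> LC ?S z'" by blast
            then show "w \<in> LC ?S z'" using linc[OF LC_lin _ zm, of ?w 1 "w s"] by simp
          qed
        qed
        then show ?thesis unfolding im img .
      qed
    qed
    moreover have "boundaries X (\<sigma> ` {..<i}) k = LC {j\<in>D. e j < i \<and> card (\<sigma> j) = Suc k} z'" if i: "i \<le> Suc m" for i k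
    proof -
      have *: "LC {j\<in>D. e j < i \<and> card (\<sigma> j) = Suc k} z' = LC {j\<in>D. e j < i \<and> card (\<sigma> j) = Suc k} z" for i
        by (rule zP)
      show ?thesis
      proof (cases "i = Suc m")
        case False
        then show ?thesis using bou[of i k] i * by auto
      next
        case im: True
        have "{j\<in>D. e j < i \<and> card (\<sigma> j) = Suc k} = {j\<in>D. e j < m \<and> card (\<sigma> j) = Suc k}" using im em by force
        moreover have "(boundaries X (insert s K) k :: ('a set \<Rightarrow> 'k) set) = boundaries X K k"
        proof (cases "Suc k = k0")
          case False then show ?thesis using chk by (simp add: boundaries_def)
        next
          case True
          show ?thesis unfolding boundaries_def True
          proof (rule equalityI[OF subsetI image_mono[OF mono]])
            fix y :: "'a set \<Rightarrow> 'k" assume "y \<in> boundary_map X ` simplicial_chains (insert s K) k0"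
            then obtain w where w: "w \<in> simplicial_chains (insert s K) k0" "y = boundary_map X w" by blast
            have "y = boundary_map X (\<lambda>A. w s * c A + 1 * (w A - w s * es A))"
              unfolding bd_lin c(2) w(2) bdd by simp
            moreover have "(\<lambda>A. w s * c A + 1 * (w A - w s * es A)) \<in> simplicial_chains K k0"
              by (rule linc[OF chains_lin c(1) dec[OF w(1)]])
            ultimately show "y \<in> boundary_map X ` simplicial_chains K k0" by blast
          qed
        qed
        ultimately show ?thesis using bou[of m k] * unfolding im img K_def by simp
      qed
    qed
    moreover have "z' j (\<sigma> j) \<noteq> 0 \<and> z' j \<in> cycles X (\<sigma> ` {..<Suc j}) (card (\<sigma> j) - 1)" if "j \<in> P'" for j
    proof (cases "j = m")
      case True
      then show ?thesis using zc cs k0 img by (simp add: z'm es_def s_def)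
    next
      case False then show ?thesis using that z z'j by (auto simp: P'_def)
    qed
    moreover have "{..<Suc m} - P' = {..<m} - P" by (auto simp: P'_def)
    moreover have "P' \<subseteq> {..<Suc m}" "D \<subseteq> P'" using P D by (auto simp: P'_def)
    ultimately show ?thesis using e de by (intro exI[of _ P'] exI[of _ D] exI[of _ e] exI[of _ z']) simp
  next
    case False
    have "k0 \<noteq> 0"
    proof
      assume "k0 = 0"
      then have "boundary_map X es = boundary_map X (\<lambda>_. 0)" using bd_deg0[where X=X and K="insert s K", OF _ fK, of es] es by (simp add: bd0)
      then show False using False lin0[OF chains_lin] by metis
    qed
    then obtain k1 where k1: "k0 = Suc k1" using not0_implies_Suc by blast
    let ?Q = "{j\<in>P. j < m \<and> card (\<sigma> j) = Suc k1}" and ?B = "{j\<in>D. e j < m \<and> card (\<sigma> j) = Suc k1}"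
    have fQ: "finite ?Q" using finP by simp
    have BQ: "?B \<subseteq> ?Q" using D P by auto
    have "boundary_map X es \<in> LC ?Q z" using bdcy[OF k1] cyc[of m k1] by (simp add: K_def)
    then obtain c where c: "boundary_map X es = (\<lambda>A. \<Sum>j\<in>?Q. c j * z j A)" using LC_E by blast
    define u where "u = (\<lambda>A. \<Sum>j\<in>?Q - ?B. c j * z j A)"
    define b where "b = (\<lambda>A. \<Sum>j\<in>?B. c j * z j A)"
    have eub: "boundary_map X es = (\<lambda>A. u A + b A)" unfolding c u_def b_def 
      by (rule ext) (rule sum.subset_diff[OF BQ fQ])
    have bB: "b \<in> boundaries X K k1" unfolding K_def bou[OF order_refl] b_def by (rule LC_I)
    have "\<exists>j\<in>?Q-?B. c j \<noteq> 0"
    proof (rule ccontr)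
      assume "\<not> ?thesis"
      then have "u = (\<lambda>_. 0)" unfolding u_def by (intro ext sum.neutral) auto
      then have "boundary_map X es \<in> boundaries X K k1" using eub bB by simp
      then show False using False k1 by (auto simp: boundaries_def)
    qed
    define J where "J = {j\<in>?Q-?B. c j \<noteq> 0}"
    have fJ: "finite J" "J \<noteq> {}" using fQ \<open>\<exists>j\<in>?Q-?B. c j \<noteq> 0\<close> by (auto simp: J_def)
    define q where "q = Max J"
    have qJ: "q \<in> J" using fJ by (simp add: q_def)
    have qmax: "j \<le> q" if "j \<in> J" for j using fJ that by (simp add: q_def)
    have q: "q \<in> P" "q < m" "card (\<sigma> q) = Suc k1" "q \<notin> D" "c q \<noteq> 0" using qJ em by (auto simp: J_def)
    have uJ: "u = (\<lambda>A. \<Sum>j\<in>J. c j * z j A)" unfolding u_def J_def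
      by (rule ext, rule sum.mono_neutral_right) (use fQ in auto)
    have uq: "u = (\<lambda>A. c q * z q A + (\<Sum>j\<in>J-{q}. c j * z j A))" unfolding uJ
      by (rule ext) (rule sum.remove[OF fJ(1) qJ])
    have JP: "J \<subseteq> P" "\<And>j. j \<in> J \<Longrightarrow> card (\<sigma> j) = Suc k1" by (auto simp: J_def)
    define z' where "z' = z(q := u)"
    define D' where "D' = insert q D"
    define e' where "e' = e(q := m)"
    have LCeq: "LC S z' = LC S z" if fS: "finite S" and qS: "q \<in> S \<Longrightarrow> J \<subseteq> S" for S
    proof (cases "q \<in> S")
      case False then show ?thesis by (intro LC_cong) (auto simp: z'_def)
    next
      case True
      then have JS: "J \<subseteq> S" using qS by blast
      show ?thesis
      proof (intro equalityI LC_least[OF fS LC_lin])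
        fix j assume "j \<in> S"
        have "u \<in> LC S z" unfolding uJ by (rule lin_sum[OF LC_lin fJ(1)], rule LC_base[OF fS]) (use JS in auto)
        then show "z' j \<in> LC S z" using LC_base[OF fS \<open>j \<in> S\<close>, of z] by (auto simp: z'_def)
      next
        fix j assume j: "j \<in> S"
        show "z j \<in> LC S z'"
        proof (cases "j = q")
          case False then show ?thesis using LC_base[OF fS j, of z'] by (auto simp: z'_def)
        next
          case True
          have zq: "z q = (\<lambda>A. inverse (c q) * z' q A + (- inverse (c q)) * (\<Sum>i\<in>J-{q}. c i * z' i A))"
          proof
            fix A
            have "(\<Sum>i\<in>J-{q}. c i * z' i A) = (\<Sum>i\<in>J-{q}. c i * z i A)" by (rule sum.cong) (auto simp: z'_def)
            then show "z q A = inverse (c q) * z' q A + (- inverse (c q)) * (\<Sum>i\<in>J-{q}. c i * z' i A)"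
              using q(5) fun_cong[OF uq, of A] by (simp add: z'_def field_simps)
          qed
          have 1: "z' q \<in> LC S z'" using LC_base[OF fS] True j by simp
          have 2: "(\<lambda>A. \<Sum>i\<in>J-{q}. c i * z' i A) \<in> LC S z'"
            by (rule lin_sum[OF LC_lin], use fJ in simp, rule LC_base[OF fS]) (use JS in auto)
          have "z q \<in> LC S z'" using linc[OF LC_lin 1 2, of "inverse (c q)" "- inverse (c q)"] zq by simp
          then show ?thesis using True by simp
        qed
      qed
    qed
    have cyc': "cycles X (\<sigma> ` {..<i}) k = LC {j\<in>P. j < i \<and> card (\<sigma> j) = Suc k} z'" if i: "i \<le> Suc m" for i k
    proof -
      let ?S = "{j\<in>P. j < i \<and> card (\<sigma> j) = Suc k}"
      have *: "LC ?S z' = LC ?S z"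
        by (rule LCeq) (use finP JP qmax q in \<open>auto intro: le_less_trans\<close>)
      show ?thesis
      proof (cases "i = Suc m")
        case False then show ?thesis using i cyc[of i k] * by simp
      next
        case im: True
        have "?S = {j\<in>P. j < m \<and> card (\<sigma> j) = Suc k}" using im by (auto dest: Pm)
        moreover have "(cycles X (insert s K) k :: ('a set \<Rightarrow> 'k) set) = cycles X K k"
        proof (cases "k = k0")
          case ne: False show ?thesis using chk[OF ne] by (simp add: cycles_def)
        next
          case True
          have "w \<in> cycles X K k" if w: "w \<in> cycles X (insert s K) k" for w :: "'a set \<Rightarrow> 'k"
          proof (cases "w s = 0")
            case w0: True
            then show ?thesis using w by (auto simp: cycles_def simplicial_chains_def)
          next
            case ws: False
            have wc: "w \<in> simplicial_chains (insert s K) k0" "boundary_map X w = (\<lambda>_. 0)" using w True by (auto simp: cycles_def)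
            let ?w = "\<lambda>A. w A - w s * es A"
            have "boundary_map X (\<lambda>A. (- inverse (w s)) * ?w A) = (\<lambda>A. (- inverse (w s)) * boundary_map X ?w A)"
              using bd_lin[of X "- inverse (w s)" ?w 0 ?w] by simp
            also have "\<dots> = boundary_map X es" unfolding bdd wc(2) using ws by auto
            finally show ?thesis using False lin_scale[OF chains_lin dec[OF wc(1)], of "- inverse (w s)"] by metis
          qed
          moreover have "(cycles X K k :: ('a set \<Rightarrow> 'k) set) \<subseteq> cycles X (insert s K) k" using mono[of k] by (auto simp: cycles_def)
          ultimately show ?thesis by blast
        qed
        ultimately show ?thesis using cyc[of m k] * unfolding im img K_def by simp
      qed
    qed
    have bou': "boundaries X (\<sigma> ` {..<i}) k = LC {j\<in>D'. e' j < i \<and> card (\<sigma> j) = Suc k} z'" if i: "i \<le> Suc m" for i k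
    proof -
      have D0: "LC {j\<in>D. e j < i \<and> card (\<sigma> j) = Suc k} z' = LC {j\<in>D. e j < i \<and> card (\<sigma> j) = Suc k} z" for i k
        by (rule LC_cong) (use q in \<open>auto simp: z'_def\<close>)
      show ?thesis
      proof (cases "i = Suc m")
        case False
        then have "{j\<in>D'. e' j < i \<and> card (\<sigma> j) = Suc k} = {j\<in>D. e j < i \<and> card (\<sigma> j) = Suc k}"
          using i q by (auto simp: D'_def e'_def)
        then show ?thesis using False i bou[of i k] D0 by simp
      next
        case im: True
        show ?thesis
        proof (cases "k = k1")
          case False
          then have "{j\<in>D'. e' j < i \<and> card (\<sigma> j) = Suc k} = {j\<in>D. e j < m \<and> card (\<sigma> j) = Suc k}"
            using im q em by (auto simp: D'_def e'_def less_Suc_eq)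
          moreover have "(boundaries X (insert s K) k :: ('a set \<Rightarrow> 'k) set) = boundaries X K k"
            using chk[of "Suc k"] False k1 by (simp add: boundaries_def)
          ultimately show ?thesis using bou[of m k] D0 unfolding im img K_def by simp
        next
          case True
          let ?S = "{j\<in>D'. e' j < i \<and> card (\<sigma> j) = Suc k}"
          have S: "?S = insert q ?B" using im q em True by (auto simp: D'_def e'_def less_Suc_eq)
          have fS: "finite ?S" unfolding S using finite_subset[OF BQ fQ] by simp
          have BK: "boundaries X K k1 = LC ?B z'" using bou[of m k1] D0 by (simp add: K_def)
          have Bsub: "(boundaries X K k1 :: ('a set \<Rightarrow> 'k) set) \<subseteq> boundaries X (insert s K) k1" 
            unfolding boundaries_def by (intro image_mono mono)
          have bes: "boundary_map X es \<in> boundaries X (insert s K) k1" using es k1 by (auto simp: boundaries_def)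
          have LB: "LC ?B z' \<subseteq> LC ?S z'"
            using fS S by (intro LC_least LC_lin LC_base) auto
          have "boundaries X (insert s K) k = LC ?S z'"
          proof
            show "LC ?S z' \<subseteq> boundaries X (insert s K) k"
            proof (rule LC_least[OF fS boundaries_lin])
              fix j assume "j \<in> ?S"
              then consider "j = q" | "j \<in> ?B" using S by blast
              then show "z' j \<in> boundaries X (insert s K) k"
              proof cases
                case 1
                have "u = (\<lambda>A. boundary_map X es A - b A)" using eub by simp
                then show ?thesis using 1 lin_diff[OF boundaries_lin bes, of b] bB Bsub True by (auto simp: z'_def)
              next
                case 2
                then have "z' j \<in> LC ?B z'" using fS S by (intro LC_base) auto
                then show ?thesis using BK Bsub True by blast
              qed
            qed
            show "boundaries X (insert s K) k \<subseteq> LC ?S z'"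
            proof
              fix y :: "'a set \<Rightarrow> 'k" assume "y \<in> boundaries X (insert s K) k"
              then obtain w where w: "w \<in> simplicial_chains (insert s K) k0" "y = boundary_map X w"
                using True k1 by (auto simp: boundaries_def)
              let ?w = "\<lambda>A. w A - w s * es A"
              have "boundary_map X ?w \<in> boundaries X K k1" using dec[OF w(1)] k1 by (auto simp: boundaries_def)
              then have 1: "boundary_map X ?w \<in> LC ?S z'" using BK LB by blast
              have "u \<in> LC ?S z'" using LC_base[OF fS, of q z'] S by (simp add: z'_def)
              moreover have "b \<in> LC ?S z'" using bB BK LB by blast
              ultimately have "boundary_map X es \<in> LC ?S z'" unfolding eub by (rule lin_add[OF LC_lin])
              then have "(\<lambda>A. w s * boundary_map X es A + 1 * boundary_map X ?w A) \<in> LC ?S z'" 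
                using linc[OF LC_lin _ 1] by blast
              then show "y \<in> LC ?S z'" using bdec[of w] w(2) by simp
            qed
          qed
          then show ?thesis unfolding im img .
        qed
      qed
    qed
    have zz: "z' j (\<sigma> j) \<noteq> 0 \<and> z' j \<in> cycles X (\<sigma> ` {..<Suc j}) (card (\<sigma> j) - 1)" if j: "j \<in> P" for j
    proof (cases "j = q")
      case False then show ?thesis using z j by (auto simp: z'_def)
    next
      case True
      have "z i (\<sigma> q) = 0" if i: "i \<in> J - {q}" for i
      proof -
        have "i < q" using qmax i by force
        have "\<sigma> q \<notin> \<sigma> ` {..<Suc i}"
        proof
          assume "\<sigma> q \<in> \<sigma> ` {..<Suc i}"
          then obtain x where "x < Suc i" "\<sigma> q = \<sigma> x" by blast
          then show False using inj_onD[OF inj, of q x] q(2) \<open>i < q\<close> by simp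
        qed
        then show ?thesis using z[of i] i JP by (auto simp: cycles_def simplicial_chains_def)
      qed
      then have "u (\<sigma> q) = c q * z q (\<sigma> q)" unfolding uq by simp
      then have nz: "z' q (\<sigma> q) \<noteq> 0" using z[OF q(1)] q(5) by (simp add: z'_def)
      have "u \<in> cycles X (\<sigma> ` {..<Suc q}) k1" 
        unfolding uJ
      proof (rule lin_sum[OF cycles_lin fJ(1)])
        fix i assume i: "i \<in> J"
        have "z i \<in> cycles X (\<sigma> ` {..<Suc i}) k1" using z[of i] JP i by auto
        moreover have "\<sigma> ` {..<Suc i} \<subseteq> \<sigma> ` {..<Suc q}" using qmax[OF i] by auto
        ultimately show "z i \<in> cycles X (\<sigma> ` {..<Suc q}) k1" by (auto simp: cycles_def simplicial_chains_def)
      qed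
      then show ?thesis using nz True q by (simp add: z'_def)
    qed
    have mP: "{..<Suc m} - P = insert m ({..<m} - P)" using P by auto
    have "bij_betw e D ({..<m} - P) \<longleftrightarrow> bij_betw e' D ({..<m} - P)"
      by (rule bij_betw_cong) (use q in \<open>auto simp: e'_def\<close>)
    then have "bij_betw e' D' ({..<Suc m} - P)"
      unfolding D'_def mP using e q bij_betw_combine[of e' D "{..<m}-P" "{q}" "{m}"]
      by (auto simp: e'_def)
    moreover have "P \<subseteq> {..<Suc m}" "D' \<subseteq> P" using P D q by (auto simp: D'_def)
    moreover have "j < e' j \<and> card (\<sigma> (e' j)) = Suc (card (\<sigma> j))" if "j \<in> D'" for j
      using that de q k0 k1 by (auto simp: D'_def e'_def s_def)
    ultimately show ?thesis using cyc' bou' zz by (intro exI[of _ P] exI[of _ D'] exI[of _ e'] exI[of _ z']) simp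
  qed
qed

lemma echelon:
  fixes z :: "nat \<Rightarrow> 's \<Rightarrow> 'k::field"
  assumes S: "finite S" and d: "\<And>j. j \<in> S \<Longrightarrow> z j (\<sigma> j) \<noteq> 0"
    and tri: "\<And>i j. i \<in> S \<Longrightarrow> j \<in> S \<Longrightarrow> j < i \<Longrightarrow> z j (\<sigma> i) = 0"
    and 0: "\<And>s. (\<Sum>j\<in>S. c j * z j s) = 0" and j: "j \<in> S"
  shows "c j = 0"
proof (rule ccontr)
  assume "c j \<noteq> 0"
  define J where "J = {j\<in>S. c j \<noteq> 0}"
  have J: "finite J" "J \<noteq> {}" using S j \<open>c j \<noteq> 0\<close> by (auto simp: J_def)
  define q where "q = Max J"
  have q: "q \<in> J" using J by (simp add: q_def)
  then have qS: "q \<in> S" "c q \<noteq> 0" by (auto simp: J_def)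
  have "(\<Sum>i\<in>S. c i * z i (\<sigma> q)) = c q * z q (\<sigma> q) + (\<Sum>i\<in>S-{q}. c i * z i (\<sigma> q))"
    by (rule sum.remove[OF S qS(1)])
  also have "(\<Sum>i\<in>S-{q}. c i * z i (\<sigma> q)) = 0"
  proof (intro sum.neutral ballI)
    fix i assume i: "i \<in> S - {q}"
    show "c i * z i (\<sigma> q) = 0"
    proof (cases "c i = 0")
      case False
      then have "i \<in> J" using i by (simp add: J_def)
      then have "i \<le> q" using J by (simp add: q_def)
      then show ?thesis using tri[OF qS(1), of i] i by simp
    qed simp
  qed
  finally show False using 0 d[OF qS(1)] qS by simp
qed

lemma filt_enum:
  fixes f :: "'a set \<Rightarrow> real"
  assumes "finite S" "\<And>A B. A \<in> S \<Longrightarrow> B \<in> S \<Longrightarrow> A \<subseteq> B \<Longrightarrow> f A \<le> f B"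
  shows "\<exists>\<sigma>. bij_betw \<sigma> {..<card S} S \<and> (\<forall>j<card S. \<forall>i<j. f (\<sigma> i) \<le> f (\<sigma> j) \<and> \<not> \<sigma> j \<subset> \<sigma> i)"
  using assms
proof (induction "card S" arbitrary: S)
  case 0
  then show ?case by (intro exI[of _ undefined]) (auto simp: bij_betw_def)
next
  case (Suc n)
  then have "S \<noteq> {}" by auto
  define M where "M = Max (f ` S)"
  have M: "M \<in> f ` S" unfolding M_def using Suc.prems(1) \<open>S \<noteq> {}\<close> by (intro Max_in) auto
  then have "{A\<in>S. f A = M} \<noteq> {}" by auto
  then obtain A where A: "A \<in> S" "f A = M" and Amax: "\<And>B. B \<in> S \<Longrightarrow> f B = M \<Longrightarrow> A \<subseteq> B \<Longrightarrow> A = B"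
    using finite_has_maximal[of "{A\<in>S. f A = M}"] Suc.prems(1) by auto
  have fM: "f B \<le> f A" if "B \<in> S" for B using that Suc.prems(1) A by (auto simp: M_def)
  have nA: "\<not> A \<subset> B" if "B \<in> S" for B
  proof
    assume AB: "A \<subset> B"
    then have "f A \<le> f B" using Suc.prems(2)[OF A(1) that] by auto
    then have "f B = M" using fM[OF that] A by simp
    then show False using Amax[OF that] AB by auto
  qed
  have cS: "card (S - {A}) = n" using Suc.hyps(2) A Suc.prems(1) by simp
  have "\<exists>\<sigma>. bij_betw \<sigma> {..<card (S-{A})} (S-{A}) \<and> (\<forall>j<card (S-{A}). \<forall>i<j. f (\<sigma> i) \<le> f (\<sigma> j) \<and> \<not> \<sigma> j \<subset> \<sigma> i)"
    by (rule Suc.hyps(1)) (use cS Suc.prems in auto)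
  then obtain \<sigma> where s: "bij_betw \<sigma> {..<n} (S-{A})" "\<And>j i. j < n \<Longrightarrow> i < j \<Longrightarrow> f (\<sigma> i) \<le> f (\<sigma> j) \<and> \<not> \<sigma> j \<subset> \<sigma> i"
    unfolding cS by blast
  define \<tau> where "\<tau> = \<sigma>(n := A)"
  have "bij_betw \<tau> {..<n} (S-{A})" using s(1) by (subst bij_betw_cong[of _ _ \<sigma>]) (auto simp: \<tau>_def)
  then have "bij_betw \<tau> ({..<n} \<union> {n}) ((S-{A}) \<union> {A})"
    by (rule bij_betw_combine) (auto simp: \<tau>_def)
  moreover have "{..<n} \<union> {n} = {..<card S}" using Suc.hyps(2) by auto
  moreover have "(S-{A}) \<union> {A} = S" using A by auto
  ultimately have 1: "bij_betw \<tau> {..<card S} S" by simp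
  have 2: "f (\<tau> i) \<le> f (\<tau> j) \<and> \<not> \<tau> j \<subset> \<tau> i" if "j < card S" "i < j" for i j
  proof (cases "j = n")
    case True
    then have "\<sigma> i \<in> S" using that s(1) by (auto simp: bij_betw_def)
    then show ?thesis using True that fM nA by (simp add: \<tau>_def)
  next
    case False
    then show ?thesis using that s(2)[of j i] Suc.hyps(2) by (simp add: \<tau>_def)
  qed
  show ?case using 1 2 by blast
qed

lemma lin_dep:
  fixes M :: "'i \<Rightarrow> 'j \<Rightarrow> 'k::field"
  assumes "finite J" "finite I" "card J < card I"
  shows "\<exists>c. (\<exists>i\<in>I. c i \<noteq> 0) \<and> (\<forall>j\<in>J. (\<Sum>i\<in>I. c i * M i j) = 0)"
  using assms
proof (induction J arbitrary: I M rule: finite_induct)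
  case empty
  then obtain i where "i \<in> I" by fastforce
  then show ?case by (intro exI[of _ "\<lambda>_. 1"]) auto
next
  case (insert j0 J)
  show ?case
  proof (cases "\<forall>i\<in>I. M i j0 = 0")
    case True
    have "card J < card I" using insert by simp
    from insert.IH[OF insert.prems(1) this, of M] show ?thesis using True by auto
  next
    case False
    then obtain i0 where i0: "i0 \<in> I" "M i0 j0 \<noteq> 0" by blast
    define M' where "M' i j = M i j - M i j0 / M i0 j0 * M i0 j" for i j
    have "card J < card (I - {i0})" using insert i0 by simp
    from insert.IH[OF _ this, of M'] insert.prems(1) obtain c where
      c: "\<exists>i\<in>I-{i0}. c i \<noteq> 0" "\<And>j. j \<in> J \<Longrightarrow> (\<Sum>i\<in>I-{i0}. c i * M' i j) = 0" by auto
    define c' where "c' = c(i0 := - (\<Sum>i\<in>I-{i0}. c i * (M i j0 / M i0 j0)))"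
    have "(\<Sum>i\<in>I. c' i * M i j) = (\<Sum>i\<in>I-{i0}. c i * M' i j)" for j
    proof -
      have "(\<Sum>i\<in>I. c' i * M i j) = c' i0 * M i0 j + (\<Sum>i\<in>I-{i0}. c' i * M i j)"
        by (rule sum.remove[OF insert.prems(1) i0(1)])
      also have "(\<Sum>i\<in>I-{i0}. c' i * M i j) = (\<Sum>i\<in>I-{i0}. c i * M i j)"
        by (rule sum.cong) (auto simp: c'_def)
      also have "c' i0 * M i0 j = (\<Sum>i\<in>I-{i0}. - (c i * (M i j0 / M i0 j0 * M i0 j)))"
        by (simp add: c'_def sum_distrib_right sum_negf mult.assoc)
      finally show ?thesis by (simp add: M'_def sum.distrib[symmetric] algebra_simps)
    qed
    then have "\<forall>j\<in>insert j0 J. (\<Sum>i\<in>I. c' i * M i j) = 0" using c(2) i0 by (auto simp: M'_def)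
    moreover have "\<exists>i\<in>I. c' i \<noteq> 0" using c(1) by (auto simp: c'_def)
    ultimately show ?thesis by blast
  qed
qed

lemma ex1_imp_eq: "\<exists>!x. P x \<Longrightarrow> P a \<Longrightarrow> P b \<Longrightarrow> a = b" by blast

lemma interval_decompositionD:
  assumes "interval_decomposition Z B I a b g"
  shows "finite I" "i \<in> I \<Longrightarrow> ereal (a i) < b i" "i \<in> I \<Longrightarrow> g i \<in> Z (a i)"
    "z \<in> Z r \<Longrightarrow> \<exists>!c. (\<forall>i. i \<notin> {i\<in>I. a i \<le> r \<and> ereal r < b i} \<longrightarrow> c i = 0) \<and>
      (\<lambda>s. z s - (\<Sum>i\<in>{i\<in>I. a i \<le> r \<and> ereal r < b i}. c i * g i s)) \<in> B r"
proof -
  note d = assms[unfolded interval_decomposition_def]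
  show "finite I" using d by (rule conjunct1)
  show "i \<in> I \<Longrightarrow> ereal (a i) < b i" "i \<in> I \<Longrightarrow> g i \<in> Z (a i)"
    using d[THEN conjunct2, THEN conjunct1] by blast+
  show "z \<in> Z r \<Longrightarrow> \<exists>!c. (\<forall>i. i \<notin> {i\<in>I. a i \<le> r \<and> ereal r < b i} \<longrightarrow> c i = 0) \<and>
      (\<lambda>s. z s - (\<Sum>i\<in>{i\<in>I. a i \<le> r \<and> ereal r < b i}. c i * g i s)) \<in> B r"
    by (rule d[THEN conjunct2, THEN conjunct2, THEN spec, THEN bspec])
qed

lemma alive_card_le:
  assumes 1: "interval_decomposition Z B I a b g" and 2: "interval_decomposition Z B I' a' b' g'"
    and Z: "\<And>r. lin (Z r)" "\<And>r r'. r \<le> r' \<Longrightarrow> Z r \<subseteq> Z r'" and B: "\<And>r. lin (B r)"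
  shows "card {i\<in>I. a i \<le> r \<and> ereal r < b i} \<le> card {i\<in>I'. a' i \<le> r \<and> ereal r < b' i}" (is "card ?A \<le> card ?A'")
proof (rule ccontr)
  assume "\<not> ?thesis"
  then have lt: "card ?A' < card ?A" by simp
  have fin: "finite ?A" "finite ?A'" using interval_decompositionD(1)[OF 1] interval_decompositionD(1)[OF 2] by simp_all
  have gZ: "g i \<in> Z r" if "i \<in> ?A" for i using interval_decompositionD(3)[OF 1, of i] Z(2)[of "a i" r] that by blast
  have "\<forall>i\<in>?A. \<exists>c. (\<lambda>s. g i s - (\<Sum>j\<in>?A'. c j * g' j s)) \<in> B r"
  proof
    fix i assume "i \<in> ?A"
    from ex1_implies_ex[OF interval_decompositionD(4)[OF 2 gZ[OF this]]] show "\<exists>c. (\<lambda>s. g i s - (\<Sum>j\<in>?A'. c j * g' j s)) \<in> B r"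
      by (elim exE conjE) (rule exI)
  qed
  from bchoice[OF this] obtain M where M: "\<And>i. i \<in> ?A \<Longrightarrow> (\<lambda>s. g i s - (\<Sum>j\<in>?A'. M i j * g' j s)) \<in> B r" by (elim exE) blast
  obtain c where c: "\<exists>i\<in>?A. c i \<noteq> 0" "\<And>j. j \<in> ?A' \<Longrightarrow> (\<Sum>i\<in>?A. c i * M i j) = 0"
    using lin_dep[OF fin(2,1) lt, of M] by blast
  have "(\<lambda>s. \<Sum>i\<in>?A. c i * (g i s - (\<Sum>j\<in>?A'. M i j * g' j s))) \<in> B r"
    by (rule lin_sum[OF B fin(1) M])
  moreover have "(\<Sum>i\<in>?A. c i * (g i s - (\<Sum>j\<in>?A'. M i j * g' j s))) = (\<Sum>i\<in>?A. c i * g i s)" for s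
  proof -
    have "(\<Sum>i\<in>?A. c i * (\<Sum>j\<in>?A'. M i j * g' j s)) = (\<Sum>j\<in>?A'. (\<Sum>i\<in>?A. c i * M i j) * g' j s)"
      unfolding sum_distrib_left sum_distrib_right by (subst sum.swap) (simp add: mult.assoc)
    also have "\<dots> = 0" using c(2) by (intro sum.neutral) auto
    finally show ?thesis by (simp add: right_diff_distrib sum_subtractf)
  qed
  ultimately have "(\<lambda>s. \<Sum>i\<in>?A. c i * g i s) \<in> B r" by simp
  from lin_scale[OF B this, of "-1"] have cB: "(\<lambda>s. 0 - (\<Sum>i\<in>?A. c i * g i s)) \<in> B r" by simp
  define c' where "c' i = (if i \<in> ?A then c i else 0)" for i
  have "(\<Sum>i\<in>?A. c' i * g i s) = (\<Sum>i\<in>?A. c i * g i s)" for s by (rule sum.cong) (auto simp: c'_def)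
  then have 3: "(\<forall>i. i \<notin> ?A \<longrightarrow> c' i = 0) \<and> (\<lambda>s. 0 - (\<Sum>i\<in>?A. c' i * g i s)) \<in> B r"
    using cB by (auto simp: c'_def)
  define Q where "Q c \<longleftrightarrow> (\<forall>i. i \<notin> ?A \<longrightarrow> c i = 0) \<and> (\<lambda>s. 0 - (\<Sum>i\<in>?A. c i * g i s)) \<in> B r" for c
  have "Q (\<lambda>_. 0)" using lin0[OF B] by (simp add: Q_def)
  moreover have "Q c'" unfolding Q_def by (rule 3)
  moreover have "\<exists>!c. Q c"
    unfolding Q_def by (rule interval_decompositionD(4)[OF 1 lin0[OF Z(1)]])
  ultimately have "c' = (\<lambda>_. 0)" by blast
  then show False using c(1) unfolding c'_def by (metis (lifting))
qed

lemma exp_half: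
  assumes "t > (0::real)"
  shows "((\<lambda>s. if a \<le> s then t * exp (- t * s) else 0) has_integral exp (- a * t)) UNIV"
proof -
  have "((\<lambda>s. t * exp (- t * s)) has_integral t * (exp (- t * a) / t)) {a..}"
    by (intro has_integral_mult_right has_integral_exp_minus_to_infinity assms)
  then have "((\<lambda>s. if s \<in> {a..} then t * exp (- t * s) else 0) has_integral exp (- a * t)) UNIV"
    using assms by (subst has_integral_restrict_UNIV) (simp add: mult.commute)
  then show ?thesis by simp
qed

lemma bar_integral:
  assumes t: "t > 0" and ab: "ereal a < b"
  shows "((\<lambda>s. if a \<le> s \<and> ereal s < b then t * exp (- t * s) else 0) has_integral bar_magnitude t a b) UNIV"
proof (cases b)
  case PInf
  then show ?thesis using exp_half[OF t, of a] by (simp add: bar_magnitude_def)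
next
  case MInf then show ?thesis using ab by simp
next
  case (real c)
  have "((\<lambda>s. (if a \<le> s then t * exp (- t * s) else 0) - (if c \<le> s then t * exp (- t * s) else 0)) 
    has_integral exp (- a * t) - exp (- c * t)) UNIV"
    by (intro has_integral_diff exp_half t)
  moreover have "(\<lambda>s. (if a \<le> s then t * exp (- t * s) else 0) - (if c \<le> s then t * exp (- t * s) else 0)) =
    (\<lambda>s. if a \<le> s \<and> ereal s < b then t * exp (- t * s) else 0)" using ab real by (intro ext) auto
  ultimately show ?thesis using real by (simp add: bar_magnitude_def)
qed

lemma bars_integral:
  assumes "finite I" "\<And>i. i \<in> I \<Longrightarrow> ereal (a i) < b i" "t > 0"
  shows "((\<lambda>s. real (card {i\<in>I. a i \<le> s \<and> ereal s < b i}) * (t * exp (- t * s)))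
    has_integral (\<Sum>i\<in>I. bar_magnitude t (a i) (b i))) UNIV"
proof -
  have "((\<lambda>s. \<Sum>i\<in>I. if a i \<le> s \<and> ereal s < b i then t * exp (- t * s) else 0)
    has_integral (\<Sum>i\<in>I. bar_magnitude t (a i) (b i))) UNIV"
    by (intro has_integral_sum bar_integral assms)
  moreover have "(\<Sum>i\<in>I. if a i \<le> s \<and> ereal s < b i then t * exp (- t * s) else 0) =
    real (card {i\<in>I. a i \<le> s \<and> ereal s < b i}) * (t * exp (- t * s))" for s
    using assms(1) by (simp add: sum.If_cases Int_def)
  ultimately show ?thesis by simp
qed

lemma magnitude_unique:
  assumes 1: "interval_decomposition Z B I a b g" and 2: "interval_decomposition Z B I' a' b' g'"
    and Z: "\<And>r. lin (Z r)" "\<And>r r'. r \<le> r' \<Longrightarrow> Z r \<subseteq> Z r'" and B: "\<And>r. lin (B r)" and t: "t > 0"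
  shows "(\<Sum>i\<in>I. bar_magnitude t (a i) (b i)) = (\<Sum>i\<in>I'. bar_magnitude t (a' i) (b' i))"
proof (rule has_integral_unique)
  show "((\<lambda>s. real (card {i\<in>I. a i \<le> s \<and> ereal s < b i}) * (t * exp (- t * s)))
    has_integral (\<Sum>i\<in>I. bar_magnitude t (a i) (b i))) UNIV"
    by (rule bars_integral) (use interval_decompositionD(1,2)[OF 1] t in auto)
  have "card {i\<in>I. a i \<le> s \<and> ereal s < b i} = card {i\<in>I'. a' i \<le> s \<and> ereal s < b' i}" for s
    by (rule antisym[OF alive_card_le[OF 1 2 Z B] alive_card_le[OF 2 1 Z B]])
  moreover have "((\<lambda>s. real (card {i\<in>I'. a' i \<le> s \<and> ereal s < b' i}) * (t * exp (- t * s)))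
    has_integral (\<Sum>i\<in>I'. bar_magnitude t (a' i) (b' i))) UNIV"
    by (rule bars_integral) (use interval_decompositionD(1,2)[OF 2] t in auto)
  ultimately show "((\<lambda>s. real (card {i\<in>I. a i \<le> s \<and> ereal s < b i}) * (t * exp (- t * s)))
    has_integral (\<Sum>i\<in>I'. bar_magnitude t (a' i) (b' i))) UNIV" by simp
qed

lemma persistent_magnitude_eq:
  assumes "interval_decomposition Z B I a b g"
    and "\<And>r. lin (Z r)" "\<And>r r'. r \<le> r' \<Longrightarrow> Z r \<subseteq> Z r'" and "\<And>r. lin (B r)" and "t > 0"
  shows "persistent_magnitude Z B t = (\<Sum>i\<in>I. bar_magnitude t (a i) (b i))"
  unfolding persistent_magnitude_def
proof (rule the_equality)
  show "\<exists>I' a' b' g'. interval_decomposition Z B I' a' b' g' \<and> 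
     (\<Sum>i\<in>I. bar_magnitude t (a i) (b i)) = (\<Sum>i\<in>I'. bar_magnitude t (a' i) (b' i))" using assms(1) by blast
  fix m assume "\<exists>I a b g. interval_decomposition Z B I a b g \<and> m = (\<Sum>i\<in>I. bar_magnitude t (a i) (b i))"
  then show "m = (\<Sum>i\<in>I. bar_magnitude t (a i) (b i))"
    using magnitude_unique[OF _ assms] by blast
qed

lemma initial_segment:
  fixes f :: "nat \<Rightarrow> real"
  assumes "\<And>i j. j < m \<Longrightarrow> i < j \<Longrightarrow> f i \<le> f j"
  shows "\<exists>N\<le>m. \<forall>j<m. j < N \<longleftrightarrow> f j \<le> r"
  using assms
proof (induction m)
  case (Suc m)
  have "\<exists>N\<le>m. \<forall>j<m. j < N \<longleftrightarrow> f j \<le> r" by (rule Suc.IH) (use Suc.prems in auto)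
  then obtain N where N: "N \<le> m" "\<And>j. j < m \<Longrightarrow> j < N \<longleftrightarrow> f j \<le> r" by blast
  show ?case
  proof (cases "f m \<le> r")
    case True
    then have "f j \<le> r" if "j < Suc m" for j using Suc.prems[of m j] that by (cases "j = m") auto
    then show ?thesis by (intro exI[of _ "Suc m"]) auto
  next
    case False
    then show ?thesis using N by (intro exI[of _ N]) (auto simp: less_Suc_eq)
  qed
qed auto

lemma cycles_mono: "K \<subseteq> L \<Longrightarrow> cycles X K k \<subseteq> cycles X L k"
  by (auto simp: cycles_def simplicial_chains_def)

theorem filtration_magnitude:
  fixes f :: "'a::linorder set \<Rightarrow> real"
  assumes X: "finite X" and S: "\<And>A. A \<in> S \<Longrightarrow> A \<noteq> {} \<and> A \<subseteq> X"
    and closed: "\<And>A B. B \<in> S \<Longrightarrow> A \<subset> B \<Longrightarrow> A \<noteq> {} \<Longrightarrow> A \<in> S"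
    and mono: "\<And>A B. A \<in> S \<Longrightarrow> B \<in> S \<Longrightarrow> A \<subseteq> B \<Longrightarrow> f A \<le> f B" and t: "t > 0"
  shows "(\<Sum>k<card X. (-1) ^ k * persistent_magnitude (\<lambda>r. cycles X {A\<in>S. f A \<le> r} k :: ('a set \<Rightarrow> 'k::field) set)
      (\<lambda>r. boundaries X {A\<in>S. f A \<le> r} k) t) = (\<Sum>A\<in>S. (-1) ^ (card A - 1) * exp (- f A * t))"
proof -
  have "S \<subseteq> Pow X" using S by blast
  then have finS: "finite S" using X finite_subset by blast
  define m where "m = card S"
  obtain \<sigma> where bij: "bij_betw \<sigma> {..<m} S" and
    ord: "\<And>i j. j < m \<Longrightarrow> i < j \<Longrightarrow> f (\<sigma> i) \<le> f (\<sigma> j)" "\<And>i j. j < m \<Longrightarrow> i < j \<Longrightarrow> \<not> \<sigma> j \<subset> \<sigma> i"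
    using filt_enum[of S f, OF finS mono] unfolding m_def by blast
  have inj: "inj_on \<sigma> {..<m}" and im: "\<sigma> ` {..<m} = S" using bij by (auto simp: bij_betw_def)
  have sS: "\<sigma> j \<in> S" if "j < m" for j using im that by auto
  have fin: "finite (\<sigma> j)" if "j < m" for j using S[OF sS[OF that]] X finite_subset by metis
  have cpos: "card (\<sigma> j) = Suc (card (\<sigma> j) - 1)" if "j < m" for j
    using S[OF sS[OF that]] fin[OF that] by (simp add: card_gt_0_iff)
  have cX: "card (\<sigma> j) \<le> card X" if "j < m" for j using S[OF sS[OF that]] X by (simp add: card_mono)
  have cl: "\<tau> \<in> \<sigma> ` {..<j}" if "j < m" "\<tau> \<noteq> {}" "\<tau> \<subset> \<sigma> j" for j \<tau>
  proof -
    have "\<tau> \<in> S" using closed[OF sS[OF that(1)] that(3,2)] .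
    then obtain i where i: "i < m" "\<tau> = \<sigma> i" using im by auto
    then have "\<not> j < i" "i \<noteq> j" using ord(2)[of i j] that(3) by auto
    then show ?thesis using i by auto
  qed
  obtain P D e and z :: "nat\<Rightarrow>'a set\<Rightarrow>'k" where
    P: "P \<subseteq> {..<m}" and D: "D \<subseteq> P" and e: "bij_betw e D ({..<m} - P)" and
    de: "\<And>j. j \<in> D \<Longrightarrow> j < e j \<and> card (\<sigma> (e j)) = Suc (card (\<sigma> j))" and
    z: "\<And>j. j \<in> P \<Longrightarrow> z j (\<sigma> j) \<noteq> 0 \<and> z j \<in> cycles X (\<sigma> ` {..<Suc j}) (card (\<sigma> j) - 1)" and
    cyc: "\<And>i k. i \<le> m \<Longrightarrow> cycles X (\<sigma> ` {..<i}) k = LC {j\<in>P. j < i \<and> card (\<sigma> j) = Suc k} z" and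
    bou: "\<And>i k. i \<le> m \<Longrightarrow> boundaries X (\<sigma> ` {..<i}) k = LC {j\<in>D. e j < i \<and> card (\<sigma> j) = Suc k} z"
  proof -
    have "\<forall>j<m. \<sigma> j \<noteq> {} \<and> \<sigma> j \<subseteq> X" "\<forall>j<m. \<forall>\<tau>. \<tau> \<noteq> {} \<longrightarrow> \<tau> \<subset> \<sigma> j \<longrightarrow> \<tau> \<in> \<sigma> ` {..<j}"
      using S[OF sS] cl by blast+
    from filt_ex[OF X inj this] obtain P D e and z :: "nat\<Rightarrow>'a set\<Rightarrow>'k" where
      "P \<subseteq> {..<m} \<and> D \<subseteq> P \<and> bij_betw e D ({..<m} - P) \<and>
    (\<forall>j\<in>D. j < e j \<and> card (\<sigma> (e j)) = Suc (card (\<sigma> j))) \<and>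
    (\<forall>j\<in>P. z j (\<sigma> j) \<noteq> 0 \<and> z j \<in> cycles X (\<sigma> ` {..<Suc j}) (card (\<sigma> j) - 1)) \<and>
    (\<forall>i\<le>m. \<forall>k. cycles X (\<sigma> ` {..<i}) k = LC {j\<in>P. j < i \<and> card (\<sigma> j) = Suc k} z) \<and>
    (\<forall>i\<le>m. \<forall>k. boundaries X (\<sigma> ` {..<i}) k = LC {j\<in>D. e j < i \<and> card (\<sigma> j) = Suc k} z)"
      by (elim exE)
    then show thesis by (intro that[of P D e z]) blast+
  qed
  have Pm: "j < m" if "j \<in> P" for j using P that by auto
  have em: "e j < m" if "j \<in> D" for j using e that by (auto simp: bij_betw_def)
  have DP: "j \<in> P" if "j \<in> D" for j using D that by auto
  have finP: "finite P" using P by (rule finite_subset) simp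
  have finD: "finite D" using D finP by (rule finite_subset)
  define Kr where "Kr r = {A\<in>S. f A \<le> r}" for r
  have "\<exists>N\<le>m. \<forall>j<m. j < N \<longleftrightarrow> f (\<sigma> j) \<le> r" for r by (rule initial_segment) (use ord in auto)
  then obtain N where N: "\<And>r. N r \<le> m" "\<And>r j. j < m \<Longrightarrow> j < N r \<longleftrightarrow> f (\<sigma> j) \<le> r" by metis
  have Kr: "Kr r = \<sigma> ` {..<N r}" for r
  proof -
    have "Kr r = {A\<in>\<sigma> ` {..<m}. f A \<le> r}" unfolding im Kr_def ..
    also have "\<dots> = \<sigma> ` {j\<in>{..<m}. f (\<sigma> j) \<le> r}" by blast
    also have "{j\<in>{..<m}. f (\<sigma> j) \<le> r} = {..<N r}"
    proof (rule set_eqI)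
      fix j show "j \<in> {j\<in>{..<m}. f (\<sigma> j) \<le> r} \<longleftrightarrow> j \<in> {..<N r}"
        using N(2)[of j r] N(1)[of r] by (cases "j < m") auto
    qed
    finally show ?thesis .
  qed
  define b where "b j = (if j \<in> D then ereal (f (\<sigma> (e j))) else \<infinity>)" for j
  define a where "a j = f (\<sigma> j)" for j
  define I where "I k = {j\<in>P. card (\<sigma> j) = Suc k \<and> ereal (a j) < b j}" for k
  define Zk where "Zk k = {j\<in>P. card (\<sigma> j) = Suc k}" for k
  have finI: "finite (I k)" for k using finP by (simp add: I_def)
  have cycr: "cycles X (Kr r) k = LC {j\<in>P. a j \<le> r \<and> card (\<sigma> j) = Suc k} z" for r k
  proof -
    have "{j\<in>P. j < N r \<and> card (\<sigma> j) = Suc k} = {j\<in>P. a j \<le> r \<and> card (\<sigma> j) = Suc k}"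
      using N(2)[OF Pm] by (auto simp: a_def)
    then show ?thesis unfolding Kr cyc[OF N(1)] by simp
  qed
  have bour: "boundaries X (Kr r) k = LC {j\<in>P. b j \<le> ereal r \<and> card (\<sigma> j) = Suc k} z" for r k
  proof -
    have "{j\<in>D. e j < N r \<and> card (\<sigma> j) = Suc k} = {j\<in>P. b j \<le> ereal r \<and> card (\<sigma> j) = Suc k}"
      using N(2)[OF em] DP by (auto simp: b_def split: if_splits)
    then show ?thesis unfolding Kr bou[OF N(1)] by simp
  qed
  have ab: "ereal (a j) \<le> b j" if "j \<in> P" for j
    using ord(1)[of "e j" j] de em by (auto simp: a_def b_def)
  have dec: "interval_decomposition (\<lambda>r. cycles X (Kr r) k) (\<lambda>r. boundaries X (Kr r) k) (I k) a b z" for k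
    unfolding interval_decomposition_def
  proof (intro conjI ballI allI impI)
    show "finite (I k)" by (rule finI)
  next
    fix i assume i: "i \<in> I k"
    show "ereal (a i) < b i" using i by (simp add: I_def)
    show "z i \<in> cycles X (Kr (a i)) k" unfolding cycr by (rule LC_base) (use i finP in \<open>auto simp: I_def\<close>)
    fix r assume "b i \<le> ereal r"
    then show "z i \<in> boundaries X (Kr r) k" unfolding bour by (intro LC_base) (use i finP in \<open>auto simp: I_def\<close>)
  next
    fix r and w :: "'a set \<Rightarrow> 'k" assume w: "w \<in> cycles X (Kr r) k"
    let ?A = "{i\<in>I k. a i \<le> r \<and> ereal r < b i}"
    let ?C = "{j\<in>P. a j \<le> r \<and> card (\<sigma> j) = Suc k}"
    let ?B = "{j\<in>P. b j \<le> ereal r \<and> card (\<sigma> j) = Suc k}"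
    have fC: "finite ?C" using finP by simp
    have CAB: "?C = ?A \<union> ?B" "?A \<inter> ?B = {}"
    proof -
      have "ereal (a j) < b j" if "a j \<le> r" "ereal r < b j" for j
        by (rule le_less_trans[OF _ that(2)]) (use that(1) in simp)
      moreover have "a j \<le> r" if "j \<in> P" "b j \<le> ereal r" for j
        using order_trans[OF ab[OF that(1)] that(2)] by simp
      ultimately show "?C = ?A \<union> ?B" by (auto simp: I_def not_le)
      show "?A \<inter> ?B = {}" by auto
    qed
    have fA: "finite ?A" and fB: "finite ?B" using finI[of k] finP by simp_all
    define Q where "Q c \<longleftrightarrow> (\<forall>i. i \<notin> ?A \<longrightarrow> c i = 0) \<and>
      (\<lambda>s. w s - (\<Sum>i\<in>?A. c i * z i s)) \<in> boundaries X (Kr r) k" for c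
    from LC_E[OF w[unfolded cycr]] obtain c where c: "w = (\<lambda>s. \<Sum>j\<in>?C. c j * z j s)" by (elim exE)
    define c' where "c' i = (if i \<in> ?A then c i else 0)" for i
    have "Q c'"
    proof -
      have "(\<lambda>s. w s - (\<Sum>i\<in>?A. c' i * z i s)) = (\<lambda>s. \<Sum>i\<in>?B. c i * z i s)"
      proof
        fix s
        have "w s = (\<Sum>i\<in>?A. c i * z i s) + (\<Sum>i\<in>?B. c i * z i s)"
          unfolding c CAB(1) by (rule sum.union_disjoint[OF fA fB CAB(2)])
        moreover have "(\<Sum>i\<in>?A. c' i * z i s) = (\<Sum>i\<in>?A. c i * z i s)" by (rule sum.cong) (simp_all add: c'_def)
        ultimately show "w s - (\<Sum>i\<in>?A. c' i * z i s) = (\<Sum>i\<in>?B. c i * z i s)" by simp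
      qed
      then have "(\<lambda>s. w s - (\<Sum>i\<in>?A. c' i * z i s)) \<in> boundaries X (Kr r) k"
        unfolding bour by (simp only: LC_I)
      moreover have "\<forall>i. i \<notin> ?A \<longrightarrow> c' i = 0" by (simp add: c'_def)
      ultimately show ?thesis unfolding Q_def by blast
    qed
    moreover have "c1 = c2" if Q1: "Q c1" and Q2: "Q c2" for c1 c2
    proof -
      have "(\<lambda>s. (w s - (\<Sum>i\<in>?A. c2 i * z i s)) - (w s - (\<Sum>i\<in>?A. c1 i * z i s))) \<in> boundaries X (Kr r) k"
        by (rule lin_diff[OF boundaries_lin Q2[unfolded Q_def, THEN conjunct2] Q1[unfolded Q_def, THEN conjunct2]])
      from LC_E[OF this[unfolded bour]] obtain d where d: "(\<lambda>s. (w s - (\<Sum>i\<in>?A. c2 i * z i s)) - (w s - (\<Sum>i\<in>?A. c1 i * z i s))) = (\<lambda>s. \<Sum>i\<in>?B. d i * z i s)"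
        by (elim exE)
      define h where "h i = (if i \<in> ?A then c1 i - c2 i else - d i)" for i
      have h0: "(\<Sum>i\<in>?C. h i * z i s) = 0" for s
      proof -
        have "(\<Sum>i\<in>?C. h i * z i s) = (\<Sum>i\<in>?A. h i * z i s) + (\<Sum>i\<in>?B. h i * z i s)"
          unfolding CAB(1) by (rule sum.union_disjoint[OF fA fB CAB(2)])
        also have "(\<Sum>i\<in>?A. h i * z i s) = (\<Sum>i\<in>?A. c1 i * z i s) - (\<Sum>i\<in>?A. c2 i * z i s)"
          unfolding sum_subtractf[symmetric] by (rule sum.cong) (simp_all add: h_def left_diff_distrib)
        also have "(\<Sum>i\<in>?B. h i * z i s) = - (\<Sum>i\<in>?B. d i * z i s)"
          unfolding sum_negf[symmetric] by (rule sum.cong) (use CAB(2) in \<open>auto simp: h_def\<close>)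
        finally show ?thesis using fun_cong[OF d, of s] by simp
      qed
      have tri: "z j (\<sigma> i) = 0" if "i \<in> ?C" "j \<in> ?C" "j < i" for i j
      proof -
        have ij: "i < m" "j \<in> P" using that Pm by auto
        have "\<sigma> i \<notin> \<sigma> ` {..<Suc j}"
        proof
          assume "\<sigma> i \<in> \<sigma> ` {..<Suc j}"
          then obtain x where "x < Suc j" "\<sigma> i = \<sigma> x" by blast
          then show False using inj_onD[OF inj, of i x] ij \<open>j < i\<close> by simp
        qed
        then show ?thesis using z[OF ij(2)] by (auto simp: cycles_def simplicial_chains_def)
      qed
      have hz: "h i = 0" if "i \<in> ?C" for i
        by (rule echelon[where z=z and \<sigma>=\<sigma> and c=h, OF fC _ tri h0 that]) (use z in auto)
      show ?thesis
      proof
        fix i show "c1 i = c2 i"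
        proof (cases "i \<in> ?A")
          case True
          then have "i \<in> ?C" using CAB(1) by blast
          from hz[OF this] show ?thesis using True by (simp add: h_def)
        next
          case False then show ?thesis using Q1 Q2 unfolding Q_def by metis
        qed
      qed
    qed
    ultimately have "\<exists>!c. Q c" by blast
    then show "\<exists>!c. (\<forall>i. i \<notin> ?A \<longrightarrow> c i = 0) \<and>
      (\<lambda>s. w s - (\<Sum>i\<in>?A. c i * z i s)) \<in> boundaries X (Kr r) k" unfolding Q_def .
  qed
  have pm: "persistent_magnitude (\<lambda>r. cycles X (Kr r) k :: ('a set \<Rightarrow> 'k) set) (\<lambda>r. boundaries X (Kr r) k) t
    = (\<Sum>j\<in>Zk k. bar_magnitude t (a j) (b j))" for k
  proof -
    have "persistent_magnitude (\<lambda>r. cycles X (Kr r) k :: ('a set \<Rightarrow> 'k) set) (\<lambda>r. boundaries X (Kr r) k) t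
      = (\<Sum>j\<in>I k. bar_magnitude t (a j) (b j))"
      by (rule persistent_magnitude_eq[OF dec cycles_lin cycles_mono boundaries_lin t]) (auto simp: Kr_def)
    also have "\<dots> = (\<Sum>j\<in>Zk k. bar_magnitude t (a j) (b j))"
    proof (rule sum.mono_neutral_left)
      show "\<forall>i\<in>Zk k - I k. bar_magnitude t (a i) (b i) = 0"
      proof
        fix i assume "i \<in> Zk k - I k"
        then have "b i = ereal (a i)" using ab[of i] by (auto simp: Zk_def I_def)
        then show "bar_magnitude t (a i) (b i) = 0" by (simp add: bar_magnitude_def)
      qed
    qed (use finP in \<open>auto simp: Zk_def I_def\<close>)
    finally show ?thesis .
  qed
  define E where "E j = (-1::real) ^ (card (\<sigma> j) - 1) * exp (- f (\<sigma> j) * t)" for j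
  have "(\<Sum>k<card X. (-1) ^ k * (\<Sum>j\<in>Zk k. bar_magnitude t (a j) (b j)))
    = (\<Sum>k<card X. \<Sum>j\<in>Zk k. (-1) ^ (card (\<sigma> j) - 1) * bar_magnitude t (a j) (b j))"
    unfolding sum_distrib_left by (intro sum.cong refl) (auto simp: Zk_def)
  also have "\<dots> = (\<Sum>j\<in>(\<Union>k<card X. Zk k). (-1) ^ (card (\<sigma> j) - 1) * bar_magnitude t (a j) (b j))"
    by (rule sum.UNION_disjoint[symmetric]) (use finP in \<open>auto simp: Zk_def\<close>)
  also have "(\<Union>k<card X. Zk k) = P"
  proof
    show "P \<subseteq> (\<Union>k<card X. Zk k)"
    proof
      fix j assume j: "j \<in> P"
      have "card (\<sigma> j) - 1 < card X" "j \<in> Zk (card (\<sigma> j) - 1)"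
        using j cpos[OF Pm[OF j]] cX[OF Pm[OF j]] unfolding Zk_def by (linarith, simp)
      then show "j \<in> (\<Union>k<card X. Zk k)" by blast
    qed
  qed (auto simp: Zk_def)
  also have "(\<Sum>j\<in>P. (-1) ^ (card (\<sigma> j) - 1) * bar_magnitude t (a j) (b j)) =
    (\<Sum>j\<in>P. E j + (if j \<in> D then E (e j) else 0))"
  proof (rule sum.cong[OF refl])
    fix j assume j: "j \<in> P"
    show "(-1) ^ (card (\<sigma> j) - 1) * bar_magnitude t (a j) (b j) = E j + (if j \<in> D then E (e j) else 0)"
    proof (cases "j \<in> D")
      case True
      have "(-1::real) ^ (card (\<sigma> (e j)) - 1) = - ((-1) ^ (card (\<sigma> j) - 1))"
        using de[OF True] cpos[OF Pm[OF j]] by (metis diff_Suc_1 power_Suc mult_minus1)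
      then show ?thesis using True by (simp add: E_def bar_magnitude_def a_def b_def algebra_simps)
    next
      case False then show ?thesis by (simp add: E_def bar_magnitude_def a_def b_def)
    qed
  qed
  also have "\<dots> = (\<Sum>j\<in>P. E j) + (\<Sum>j\<in>D. E (e j))"
    using finP D by (simp add: sum.distrib sum.If_cases Int_absorb1 Int_absorb2 Int_commute)
  also have "(\<Sum>j\<in>D. E (e j)) = (\<Sum>j\<in>{..<m} - P. E j)" by (rule sum.reindex_bij_betw[OF e])
  also have "(\<Sum>j\<in>P. E j) + (\<Sum>j\<in>{..<m} - P. E j) = (\<Sum>j<m. E j)"
    using sum.subset_diff[OF P, of E] by simp
  also have "\<dots> = (\<Sum>A\<in>S. (-1) ^ (card A - 1) * exp (- f A * t))"
    unfolding E_def by (rule sum.reindex_bij_betw[OF bij])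
  finally show ?thesis using pm unfolding Kr_def by simp
qed

text \<open>
  Consistency with the usual closed formula: the alternating sum of \<open>exp (- diam A * t)\<close> over the
  nonempty subsets of \<open>X\<close>. In particular interval decompositions exist, the persistent magnitude is
  well defined, and it depends neither on the field nor on the vertex order.
\<close>

definition metric_diam :: "('a \<Rightarrow> 'a \<Rightarrow> real) \<Rightarrow> 'a set \<Rightarrow> real" where
  "metric_diam d A = Max ((\<lambda>(x, y). d x y) ` (A \<times> A))"

theorem rips_magnitude_eq:
  fixes X :: "'a::linorder set"
  assumes X: "finite X" and t: "t > 0"
  shows "rips_magnitude TYPE('k::field) X d t =
    (\<Sum>A\<in>Pow X - {{}}. (-1) ^ (card A - 1) * exp (- metric_diam d A * t))"
proof -
  let ?S = "Pow X - {{}}"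
  have fin: "finite A" if "A \<in> ?S" for A using that X finite_subset by auto
  have "rips_complex X d r = {A \<in> ?S. metric_diam d A \<le> r}" for r
  proof (rule set_eqI)
    fix A
    show "A \<in> rips_complex X d r \<longleftrightarrow> A \<in> {A \<in> ?S. metric_diam d A \<le> r}"
    proof (cases "A \<in> ?S")
      case True
      then have "metric_diam d A \<le> r \<longleftrightarrow> (\<forall>x\<in>A. \<forall>y\<in>A. d x y \<le> r)"
        unfolding metric_diam_def using fin[OF True] by (subst Max_le_iff) auto
      then show ?thesis using True by (simp add: rips_complex_def)
    qed (auto simp: rips_complex_def)
  qed
  moreover have "metric_diam d A \<le> metric_diam d B" if "A \<in> ?S" "B \<in> ?S" "A \<subseteq> B" for A B
    unfolding metric_diam_def using that fin by (intro Max_mono image_mono) auto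
  ultimately show ?thesis
    unfolding rips_magnitude_def
    using filtration_magnitude[where S="?S" and f="metric_diam d" and 'k='k, OF X _ _ _ t] by auto
qed

lemma C_geo_metric:
  assumes "x \<in> C_geo n" "y \<in> C_geo n" "z \<in> C_geo n"
  shows "geodesic_dist x y \<ge> 0" "geodesic_dist x y = 0 \<longleftrightarrow> x = y" "geodesic_dist x y = geodesic_dist y x"
    "geodesic_dist x z \<le> geodesic_dist x y + geodesic_dist y z"
proof -
  have r: "0 \<le> x \<and> x < 2 * pi" if "x \<in> C_geo n" for x
    using that by (auto simp: C_geo_def field_simps)
  note r = r[OF assms(1)] r[OF assms(2)] r[OF assms(3)]
  show "geodesic_dist x y = geodesic_dist y x" by (simp add: geodesic_dist_def abs_minus_commute)
  show "geodesic_dist x y \<ge> 0" "geodesic_dist x y = 0 \<longleftrightarrow> x = y"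
    using r by (auto simp: geodesic_dist_def min_def)
  show "geodesic_dist x z \<le> geodesic_dist x y + geodesic_dist y z" 
    using r unfolding geodesic_dist_def by linarith
qed

lemma C_geo_card: "card (C_geo n) = n"
proof -
  have "inj_on (\<lambda>j. 2 * pi * real j / real n) {..<n}" by (auto simp: inj_on_def)
  then show ?thesis by (simp add: C_geo_def card_image)
qed

end

theory Submission
  imports Defs
begin

text \<open>
  The alternating sum over subsets groups into the Euler characteristics of the complexes of
  subsets of \<open>\<int>/n\<close> of cyclic diameter at most \<open>k\<close>, for \<open>2 * k < n\<close>. Mark every point of such a
  subset together with its antipode on the circle, in two colours: two points of different colours
  are at least \<open>d = n - 2 * k\<close> half-steps apart. Inside a monochromatic run, the points other than
  the first one may be added and removed freely, as long as the run stays \<open>d\<close> half-steps away from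
  the next one. Toggling such a free point reverses the sign, so only the subsets without
  free points contribute. In these all runs are single points with consecutive distances exactly
  \<open>d\<close>, that is, the subset is invariant under translation by \<open>k\<close>. They are the \<open>d\<close> cosets of
  \<open>d\<int>/n\<close>, of odd cardinality \<open>n / d\<close>, and exist only if \<open>d\<close> divides \<open>k\<close>. Hence the Euler
  characteristic is \<open>d\<close> or \<open>0\<close>, and \<open>r = n / d\<close> runs over the odd divisors of \<open>n\<close>.
\<close>

section \<open>Alternating sums over families of finite sets\<close>

text \<open>Sign-reversing involution: toggle an element of \<open>fr A\<close> picked by
  \<open>SOME\<close>. The pick depends on \<open>fr A\<close> only, which the toggle preserves, so
  toggling twice restores \<open>A\<close>, while the parity of the cardinality flips.\<close>

lemma sum_sign_toggle:
  fixes F :: "'a set set" and fr :: "'a set \<Rightarrow> 'a set"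
  assumes F: "finite F" "\<And>A. A \<in> F \<Longrightarrow> finite A"
    and tog: "\<And>A x. A \<in> F \<Longrightarrow> x \<in> fr A \<Longrightarrow>
      (if x \<in> A then A - {x} else insert x A) \<in> F \<and> fr (if x \<in> A then A - {x} else insert x A) = fr A"
  shows "(\<Sum>A\<in>F. (-1) ^ card A) = (\<Sum>A | A \<in> F \<and> fr A = {}. (-1) ^ card A :: real)"
proof -
  define T where "T A = (let x = SOME x. x \<in> fr A in if x \<in> A then A - {x} else insert x A)" for A
  let ?G = "{A \<in> F. fr A \<noteq> {}}"
  have some: "(SOME x. x \<in> fr A) \<in> fr A" if "A \<in> ?G" for A
    using that by (simp add: some_in_eq)
  have T: "T A \<in> ?G" "fr (T A) = fr A" if "A \<in> ?G" for A
    using tog[of A, OF _ some[OF that]] that by (simp_all add: T_def Let_def)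
  have TT: "T (T A) = A" if "A \<in> ?G" for A
    using T(2)[OF that] by (auto simp: T_def Let_def)
  have sgn: "(-1::real) ^ card (T A) = - ((-1) ^ card A)" if A: "A \<in> ?G" for A
  proof -
    define x where "x = (SOME x. x \<in> fr A)"
    have "finite A" using A F by auto
    then show ?thesis
    proof (cases "x \<in> A")
      case True
      then have "card A = Suc (card (A - {x}))" using \<open>finite A\<close> by (rule card.remove[rotated])
      then have "(-1::real) ^ card A = - ((-1) ^ card (A - {x}))" by (simp only: power_Suc mult_minus1)
      then show ?thesis using True by (simp add: T_def Let_def x_def[symmetric])
    qed (simp add: T_def Let_def x_def[symmetric])
  qed
  have "(\<Sum>A\<in>?G. (-1::real) ^ card A) = (\<Sum>A\<in>?G. - ((-1) ^ card A))"
    by (rule sum.reindex_bij_witness[where i = T and j = T]) (use T TT sgn in auto)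
  then have "(\<Sum>A\<in>?G. (-1::real) ^ card A) = 0" by (simp add: sum_negf)
  moreover have "(\<Sum>A\<in>F. (-1::real) ^ card A) =
      (\<Sum>A\<in>?G. (-1) ^ card A) + (\<Sum>A | A \<in> F \<and> fr A = {}. (-1) ^ card A)"
  proof -
    let ?H = "{A \<in> F. fr A = {}}"
    have FGH: "F = ?G \<union> ?H" by blast
    have "sum f (?G \<union> ?H) = sum f ?G + sum f ?H" for f :: "'a set \<Rightarrow> real"
      by (rule sum.union_disjoint) (use F in auto)
    then show ?thesis unfolding FGH[symmetric] .
  qed
  ultimately show ?thesis by simp
qed

lemma sum_sign_pred_card:
  assumes "\<And>A. A \<in> F \<Longrightarrow> finite A \<and> A \<noteq> {}"
  shows "(\<Sum>A\<in>F. (-1::real) ^ (card A - 1)) = - (\<Sum>A\<in>F. (-1) ^ card A)"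
  unfolding sum_negf[symmetric]
proof (intro sum.cong refl)
  fix A assume "A \<in> F"
  then have "card A \<noteq> 0" using assms by (simp add: card_eq_0_iff)
  then show "(-1::real) ^ (card A - 1) = - ((-1) ^ card A)" by (cases "card A") auto
qed

text \<open>Abel summation: \<open>g (m A)\<close> telescopes from \<open>m A\<close> up to
  \<open>M\<close>, so each difference of consecutive values of \<open>g\<close> is weighted by the
  sum of \<open>s\<close> over a sublevel set of \<open>m\<close>. With signs for \<open>s\<close>,
  these inner sums are Euler characteristics.\<close>

lemma sum_layers:
  fixes g :: "nat \<Rightarrow> real"
  assumes S: "finite S" and m: "\<And>A. A \<in> S \<Longrightarrow> m A \<le> M"
  shows "(\<Sum>A\<in>S. s A * g (m A)) =
    g M * (\<Sum>A\<in>S. s A) + (\<Sum>k<M. (g k - g (Suc k)) * (\<Sum>A | A \<in> S \<and> m A \<le> k. s A))"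
proof -
  have tel: "g (m A) = g M + (\<Sum>k<M. if m A \<le> k then g k - g (Suc k) else 0)" if "A \<in> S" for A
  proof -
    have "(\<Sum>k<M. if m A \<le> k then g k - g (Suc k) else 0) = (\<Sum>k = m A..<M. g k - g (Suc k))"
      by (rule sum.mono_neutral_cong_right) auto
    also have "\<dots> = - (\<Sum>k = m A..<M. g (Suc k) - g k)" by (simp add: sum_negf[symmetric])
    also have "\<dots> = g (m A) - g M" using m[OF that] by (simp add: sum_Suc_diff')
    finally show ?thesis by simp
  qed
  have "(\<Sum>A\<in>S. s A * g (m A)) =
      (\<Sum>A\<in>S. s A * g M + (\<Sum>k<M. if m A \<le> k then (g k - g (Suc k)) * s A else 0))"
    by (intro sum.cong refl) (auto simp: tel distrib_left sum_distrib_left mult.commute intro!: sum.cong)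
  also have "\<dots> = g M * (\<Sum>A\<in>S. s A) + (\<Sum>k<M. \<Sum>A\<in>S. if m A \<le> k then (g k - g (Suc k)) * s A else 0)"
    by (simp add: sum.distrib sum_distrib_left mult.commute sum.swap[of _ S])
  also have "(\<Sum>k<M. \<Sum>A\<in>S. if m A \<le> k then (g k - g (Suc k)) * s A else 0) =
      (\<Sum>k<M. (g k - g (Suc k)) * (\<Sum>A | A \<in> S \<and> m A \<le> k. s A))"
    using S by (simp add: sum_distrib_left sum.inter_filter[symmetric])
  finally show ?thesis .
qed

lemma card_residue_class:
  fixes c d m :: int
  assumes c: "0 \<le> c" "c < d" and m: "0 \<le> m"
  shows "card {z \<in> {0..<d * m}. z mod d = c} = nat m"
proof -
  have d: "0 < d" using c by simp
  have "bij_betw (\<lambda>i. c + d * i) {0..<m} {z \<in> {0..<d * m}. z mod d = c}"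
  proof (rule bij_betwI[where g = "\<lambda>z. z div d"])
    show "(\<lambda>i. c + d * i) \<in> {0..<m} \<rightarrow> {z \<in> {0..<d * m}. z mod d = c}"
    proof
      fix i assume i: "i \<in> {0..<m}"
      have "d * (i + 1) \<le> d * m" by (rule mult_left_mono) (use i c in auto)
      then have "c + d * i < d * m" using c by (simp add: distrib_left)
      moreover have "0 \<le> d * i" using c i by simp
      ultimately show "c + d * i \<in> {z \<in> {0..<d * m}. z mod d = c}" using c by simp
    qed
    show "(\<lambda>z. z div d) \<in> {z \<in> {0..<d * m}. z mod d = c} \<rightarrow> {0..<m}"
    proof
      fix z assume z: "z \<in> {z \<in> {0..<d * m}. z mod d = c}"
      have "z mod d + d * (z div d) = z" by (rule mod_mult_div_eq)
      moreover have "0 \<le> z mod d" "z < d * m" using z c by simp_all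
      ultimately have "d * (z div d) < d * m" by linarith
      then have "z div d < m" by (simp only: mult_less_cancel_left_pos[OF d])
      then show "z div d \<in> {0..<m}" using z d by (simp add: pos_imp_zdiv_nonneg_iff)
    qed
    show "(c + d * i) div d = i" if "i \<in> {0..<m}" for i using c by simp
    show "c + d * (z div d) = z" if z: "z \<in> {z \<in> {0..<d * m}. z mod d = c}" for z
      using z mod_mult_div_eq[of z d] by simp
  qed
  from bij_betw_same_card[OF this] show ?thesis by simp
qed

section \<open>Cliques in Z/n and their free points\<close>

locale cyclic_rips =
  fixes n k :: int
  assumes k_nonneg: "0 \<le> k" and k_less: "2 * k < n"
begin

text \<open>A subset of Z/n is represented by its full preimage in the integers, so that order and
  intervals can be used without wrap-around.\<close>

definition periodic :: "int set \<Rightarrow> bool" where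
  "periodic P \<longleftrightarrow> (\<forall>z. z + n \<in> P \<longleftrightarrow> z \<in> P)"

text \<open>For periodic \<open>P\<close> this bounds all cyclic distances by \<open>k\<close>: two
  residues farther apart have representatives whose difference lies strictly between
  \<open>k\<close> and \<open>n - k\<close>.\<close>

definition clique :: "int set \<Rightarrow> bool" where
  "clique P \<longleftrightarrow> (\<forall>u\<in>P. \<forall>v\<in>P. \<not> (k < v - u \<and> v - u < n - k))"

text \<open>
  \<open>free P x\<close>: the point \<open>x\<close> continues the run of some earlier \<open>a\<close>. The points \<open>b\<close> in
  \<open>{a - k..<x - k}\<close> are those whose antipode \<open>b + n / 2\<close> would end this run too early.
\<close>

definition free :: "int set \<Rightarrow> int \<Rightarrow> bool" where
  "free P x \<longleftrightarrow> (\<exists>a\<in>P. a < x \<and> x \<le> a + k \<and> P \<inter> {a - k..<x - k} = {})"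

lemma periodicD:
  assumes "periodic P"
  shows "z + n * i \<in> P \<longleftrightarrow> z \<in> P"
proof (induction i rule: int_induct[where k = 0])
  case (step1 i)
  then show ?case
    using assms[unfolded periodic_def, rule_format, of "z + n * i"] by (simp add: algebra_simps)
next
  case (step2 i)
  then show ?case
    using assms[unfolded periodic_def, rule_format, of "z + n * (i - 1)"] by (simp add: algebra_simps)
qed simp

lemma cliqueD: "clique P \<Longrightarrow> u \<in> P \<Longrightarrow> v \<in> P \<Longrightarrow> k < v - u \<Longrightarrow> n - k \<le> v - u"
  unfolding clique_def by force

lemma free_shift:
  assumes P: "periodic P" and x: "free P x"
  shows "free P (x + n * i)"
proof -
  obtain a where a: "a \<in> P" "a < x" "x \<le> a + k" "P \<inter> {a - k..<x - k} = {}"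
    using x unfolding free_def by blast
  have "P \<inter> {a + n * i - k..<x + n * i - k} = {}"
  proof (rule equals0I)
    fix u assume "u \<in> P \<inter> {a + n * i - k..<x + n * i - k}"
    then have "u + n * (- i) \<in> P \<inter> {a - k..<x - k}"
      using periodicD[OF P, of u "- i"] by auto
    then show False using a by blast
  qed
  then show ?thesis
    unfolding free_def using a periodicD[OF P, of a i] by (intro bexI[of _ "a + n * i"]) auto
qed

lemma clique_insert:
  assumes P: "periodic P" "clique P" and x: "free P x"
  shows "clique (P \<union> range (\<lambda>i. x + n * i))"
  unfolding clique_def
proof (intro ballI notI)
  fix u v
  assume u: "u \<in> P \<union> range (\<lambda>i. x + n * i)" and v: "v \<in> P \<union> range (\<lambda>i. x + n * i)"
    and uv: "k < v - u \<and> v - u < n - k"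
  \<comment> \<open>Here \<open>w\<close> is ahead of \<open>y\<close>. The clique property with
    \<open>a\<close> pushes \<open>w\<close> so far that \<open>w - n\<close> falls into the empty
    window.\<close>
  have after: False if w: "w \<in> P" "free P y" "k < w - y" "w - y < n - k" for w y
  proof -
    obtain a where a: "a \<in> P" "a < y" "y \<le> a + k" "P \<inter> {a - k..<y - k} = {}"
      using w(2) unfolding free_def by blast
    have "n - k \<le> w - a" using cliqueD[OF P(2) a(1) w(1)] a w by linarith
    moreover have "w - n \<in> P" using periodicD[OF P(1), of w "-1"] w by simp
    moreover have "w - n \<notin> {a - k..<y - k}" using a(4) calculation by blast
    ultimately show False using a w by auto
  qed
  \<comment> \<open>Here \<open>w\<close> is behind \<open>y\<close>. Being outside the window, it
    lies below \<open>a - k\<close>, hence already at a forbidden distance from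
    \<open>a\<close>.\<close>
  have before: False if w: "w \<in> P" "free P y" "k < y - w" "y - w < n - k" for w y
  proof -
    obtain a where a: "a \<in> P" "a < y" "y \<le> a + k" "P \<inter> {a - k..<y - k} = {}"
      using w(2) unfolding free_def by blast
    have "w \<notin> {a - k..<y - k}" using a(4) w by blast
    then have "k < a - w" using w by auto
    then show False using cliqueD[OF P(2) w(1) a(1)] a w by linarith
  qed
  have both: False if "k < n * j" "n * j < n - k" for j
  proof -
    have "n * 0 < n * j" "n * j < n * 1" using that k_nonneg by linarith+
    moreover have "0 < n" using k_nonneg k_less by linarith
    ultimately have "0 < j" "j < 1" by (simp_all only: mult_less_cancel_left_pos)
    then show False by simp
  qed
  show False
  proof (cases "u \<in> P")
    case True
    show ?thesis
    proof (cases "v \<in> P")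
      case True
      then show ?thesis using cliqueD[OF P(2) \<open>u \<in> P\<close> True] uv by linarith
    next
      case False
      then obtain i where "v = x + n * i" using v by blast
      then show ?thesis using before[OF \<open>u \<in> P\<close> free_shift[OF P(1) x]] uv by blast
    qed
  next
    case False
    then obtain i where i: "u = x + n * i" using u by blast
    show ?thesis
    proof (cases "v \<in> P")
      case True
      then show ?thesis using after[OF True free_shift[OF P(1) x]] uv i by blast
    next
      case False
      then obtain j where "v = x + n * j" using v by blast
      then show ?thesis using both[of "j - i"] uv i by (simp add: algebra_simps)
    qed
  qed
qed

text \<open>Freeness must be insensitive to toggling, so that the same point can be toggled back. In
  one direction an old witness keeps its empty window; in the other a new witness is replaced by its
  own witness.\<close>

lemma free_insert:
  assumes P: "periodic P" "clique P" and x: "free P x"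
  shows "free (P \<union> range (\<lambda>i. x + n * i)) y \<longleftrightarrow> free P y"
proof
  let ?Q = "P \<union> range (\<lambda>i. x + n * i)"
  assume "free P y"
  then obtain a where a: "a \<in> P" "a < y" "y \<le> a + k" "P \<inter> {a - k..<y - k} = {}"
    unfolding free_def by blast
  have "w \<notin> {a - k..<y - k}" if "w \<in> range (\<lambda>i. x + n * i)" for w
  proof
    \<comment> \<open>If a new point \<open>w\<close> hit the window of \<open>a\<close>, the
      witness \<open>b\<close> of \<open>w\<close> would be at least \<open>n - k\<close> behind
      \<open>a\<close>, which puts \<open>a - n\<close> into the window of \<open>w\<close>.\<close>
    assume w: "w \<in> {a - k..<y - k}"
    have "free P w" using that free_shift[OF P(1) x] by blast
    then obtain b where b: "b \<in> P" "b < w" "w \<le> b + k" "P \<inter> {b - k..<w - k} = {}"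
      unfolding free_def by blast
    have "b \<notin> {a - k..<y - k}" using a(4) b(1) by blast
    then have "n - k \<le> a - b" using cliqueD[OF P(2) b(1) a(1)] b w by auto
    moreover have "a - n \<in> P" using periodicD[OF P(1), of a "-1"] a by simp
    moreover have "a - n \<notin> {b - k..<w - k}" using b(4) calculation by blast
    ultimately show False using w k_less by auto
  qed
  then have "?Q \<inter> {a - k..<y - k} = {}" using a(4) by blast
  then show "free ?Q y" unfolding free_def using a by blast
next
  let ?Q = "P \<union> range (\<lambda>i. x + n * i)"
  assume "free ?Q y"
  then obtain a where a: "a \<in> ?Q" "a < y" "y \<le> a + k" "?Q \<inter> {a - k..<y - k} = {}"
    unfolding free_def by blast
  show "free P y"
  proof (cases "a \<in> P")
    case True
    then show ?thesis unfolding free_def using a by blast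
  next
    case False
    then have "free P a" using a(1) free_shift[OF P(1) x] by blast
    then obtain b where b: "b \<in> P" "b < a" "a \<le> b + k" "P \<inter> {b - k..<a - k} = {}"
      unfolding free_def by blast
    have "b \<notin> {a - k..<y - k}" using a(4) b(1) by blast
    then have "y \<le> b + k" using b by auto
    \<comment> \<open>The windows of \<open>b\<close> for \<open>a\<close> and of \<open>a\<close>
      for \<open>y\<close> abut at \<open>a - k\<close> and together cover this interval.\<close>
    moreover have "P \<inter> {b - k..<y - k} = {}"
    proof (rule equals0I)
      fix u assume "u \<in> P \<inter> {b - k..<y - k}"
      then have "u \<in> P \<inter> {b - k..<a - k} \<or> u \<in> ?Q \<inter> {a - k..<y - k}" by auto
      then show False using a(4) b(4) by blast
    qed
    ultimately show ?thesis unfolding free_def using a b by (intro bexI[of _ b]) auto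
  qed
qed

text \<open>The witness \<open>a\<close> satisfies \<open>0 < x - a \<le> k < n\<close>, so it is
  not a translate of \<open>x\<close> and survives the removal.\<close>

lemma free_remove:
  assumes x: "free P x"
  shows "free (P - range (\<lambda>i. x + n * i)) x"
proof -
  obtain a where a: "a \<in> P" "a < x" "x \<le> a + k" "P \<inter> {a - k..<x - k} = {}"
    using x unfolding free_def by blast
  have "a \<notin> range (\<lambda>i. x + n * i)"
  proof
    assume "a \<in> range (\<lambda>i. x + n * i)"
    then obtain i where i: "a = x + n * i" by blast
    then have "n * i < n * 0" "n * (- 1) < n * i" using a k_nonneg k_less by auto
    moreover have "0 < n" using k_nonneg k_less by linarith
    ultimately have "i < 0" "-1 < i" by (simp_all only: mult_less_cancel_left_pos)
    then show False by simp
  qed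
  then show ?thesis unfolding free_def using a by blast
qed

text \<open>Without free points, \<open>P\<close> is closed under subtracting \<open>k\<close>,
  hence under shifts by \<open>d = n - 2 * k\<close>, and the clique property leaves room for only
  one residue class mod \<open>d\<close>. Conversely, if \<open>d\<close> divides \<open>k\<close>,
  the point \<open>a - k\<close> of the class lies in every window of \<open>a\<close>.\<close>

lemma no_free_iff:
  assumes P: "periodic P" "clique P" and ne: "P \<noteq> {}"
  shows "(\<forall>x. \<not> free P x) \<longleftrightarrow> (\<exists>c. (n - 2 * k) dvd k \<and> P = {z. z mod (n - 2 * k) = c mod (n - 2 * k)})"
proof
  let ?d = "n - 2 * k"
  assume nf: "\<forall>x. \<not> free P x"
  \<comment> \<open>The absence of free points is tested at \<open>a + 1\<close>: for the witness
    \<open>a\<close> the window is the single point \<open>a - k\<close>. For \<open>k = 0\<close>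
    the claim is trivial.\<close>
  have down: "a - k \<in> P" if a: "a \<in> P" for a
  proof (cases "k = 0")
    case False
    have "{a - k..<a + 1 - k} = {a - k}" by auto
    then show ?thesis using nf[rule_format, of "a + 1"] a False k_nonneg unfolding free_def by force
  qed (use a in simp)
  have d_up: "a + ?d \<in> P" if "a \<in> P" for a
    using down[OF down[OF that]] periodicD[OF P(1), of "a - k - k" 1] by (simp add: algebra_simps)
  have d_nat: "a + ?d * int i \<in> P" if "a \<in> P" for a i
    using that by (induction i) (use d_up in \<open>force simp: algebra_simps\<close>)+
  have d_int: "a + ?d * i \<in> P" if "a \<in> P" for a i
  proof (cases "0 \<le> i")
    case True then show ?thesis using d_nat[OF that, of "nat i"] by simp
  next
    case False
    \<comment> \<open>Shifts by \<open>d * ((1 - n) * i)\<close> and \<open>d * i\<close> agree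
      modulo \<open>n\<close>, and for negative \<open>i\<close> the first multiplier is
      nonnegative, so \<open>d_nat\<close> applies.\<close>
    then have "0 \<le> (1 - n) * i" using k_nonneg k_less by (simp add: mult_nonpos_nonpos)
    then have "a + ?d * ((1 - n) * i) \<in> P" using d_nat[OF that, of "nat ((1 - n) * i)"] by simp
    then show ?thesis
      using periodicD[OF P(1), of "a + ?d * i" "- (?d * i)"] by (simp add: algebra_simps)
  qed
  obtain c where c: "c \<in> P" using ne by blast
  have P_eq: "z \<in> P \<longleftrightarrow> z mod ?d = c mod ?d" for z
  proof
    assume "z mod ?d = c mod ?d"
    then obtain i where "z = c + ?d * i" by (metis mod_eqE mult.commute mod_eq_dvd_iff dvd_def diff_add_cancel add.commute)
    then show "z \<in> P" using d_int[OF c] by simp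
  next
    assume z: "z \<in> P"
    \<comment> \<open>This is the translate of \<open>z\<close> in \<open>{c..<c + ?d}\<close>.
      Unless \<open>w = c\<close>, its difference to \<open>c - k\<close> lies strictly between
      \<open>k\<close> and \<open>n - k\<close>, against the clique property.\<close>
    define w where "w = z + ?d * (- ((z - c) div ?d))"
    have wc: "w - c = (z - c) mod ?d"
      unfolding w_def by (simp add: minus_div_mult_eq_mod[symmetric] algebra_simps)
    have w: "w \<in> P" unfolding w_def by (rule d_int[OF z])
    have "0 \<le> w - c" "w - c < ?d" using wc k_less by simp_all
    moreover have "n - k \<le> w - (c - k)" if "0 < w - c"
      by (rule cliqueD[OF P(2) down[OF c] w]) (use that in simp)
    ultimately have "(z - c) mod ?d = 0" using wc by linarith
    then show "z mod ?d = c mod ?d" by (simp add: mod_eq_dvd_iff mod_0_imp_dvd)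
  qed
  have "?d dvd k" using down[OF c] by (simp add: P_eq mod_eq_dvd_iff)
  then show "\<exists>c. ?d dvd k \<and> P = {z. z mod ?d = c mod ?d}" using P_eq by blast
next
  assume "\<exists>c. (n - 2 * k) dvd k \<and> P = {z. z mod (n - 2 * k) = c mod (n - 2 * k)}"
  then obtain c where dk: "(n - 2 * k) dvd k" and c: "P = {z. z mod (n - 2 * k) = c mod (n - 2 * k)}"
    by blast
  have down: "a - k \<in> P" if "a \<in> P" for a
    using that dvd_diff[OF _ dk, of "a - c"] by (simp add: c mod_eq_dvd_iff algebra_simps)
  show "\<forall>x. \<not> free P x"
  proof (intro allI notI)
    fix x assume "free P x"
    then obtain a where a: "a \<in> P" "a < x" "P \<inter> {a - k..<x - k} = {}" unfolding free_def by blast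
    then have "a - k \<in> {a - k..<x - k}" by simp
    moreover have "a - k \<in> P" using a(1) by (rule down)
    ultimately show False using a(3) by blast
  qed
qed

text \<open>With \<open>k = d * l\<close> one has \<open>n - k = d * (l + 1)\<close>, and no
  multiple of \<open>d\<close> lies strictly between these two.\<close>

lemma clique_coset:
  assumes "(n - 2 * k) dvd k"
  shows "clique {z. z mod (n - 2 * k) = c mod (n - 2 * k)}"
proof -
  let ?d = "n - 2 * k"
  obtain l where l: "k = ?d * l" using assms by (auto simp: dvd_def)
  show "clique {z. z mod ?d = c mod ?d}"
    unfolding clique_def
  proof (intro ballI notI)
    fix u v assume "u \<in> {z. z mod ?d = c mod ?d}" "v \<in> {z. z mod ?d = c mod ?d}"
      and uv: "k < v - u \<and> v - u < n - k"
    then have "?d dvd v - u" by (simp add: mod_eq_dvd_iff[symmetric])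
    then obtain j where j: "v - u = ?d * j" by (auto simp: dvd_def)
    have "?d * l < ?d * j" "?d * j < ?d * (l + 1)" using uv l j by (simp_all add: distrib_left)
    then have "l < j" "j < l + 1" using k_less by simp_all
    then show False by simp
  qed
qed

section \<open>Euler characteristics of the cyclic complexes\<close>

definition lift :: "int set \<Rightarrow> int set" where
  "lift A = {z. z mod n \<in> A}"

definition coset :: "int \<Rightarrow> int set" where
  "coset c = {z \<in> {0..<n}. z mod (n - 2 * k) = c}"

lemma n_pos: "0 < n"
  using k_nonneg k_less by linarith

lemma periodic_lift: "periodic (lift A)"
  by (simp add: periodic_def lift_def)

lemma lift_Int: "A \<subseteq> {0..<n} \<Longrightarrow> lift A \<inter> {0..<n} = A"
  by (auto simp: lift_def)

lemma lift_singleton: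
  assumes "x \<in> {0..<n}"
  shows "lift {x} = range (\<lambda>i. x + n * i)"
proof (intro set_eqI iffI)
  fix z assume "z \<in> lift {x}"
  then have "z = x + n * (z div n)" unfolding lift_def using mod_mult_div_eq[of z n] by auto
  then show "z \<in> range (\<lambda>i. x + n * i)" by blast
qed (use assms in \<open>auto simp: lift_def\<close>)

lemma lift_insert: "x \<in> {0..<n} \<Longrightarrow> lift (insert x A) = lift A \<union> range (\<lambda>i. x + n * i)"
  using lift_singleton[of x] unfolding lift_def by blast

lemma lift_remove: "x \<in> {0..<n} \<Longrightarrow> lift (A - {x}) = lift A - range (\<lambda>i. x + n * i)"
  using lift_singleton[of x] unfolding lift_def by blast

text \<open>Here \<open>n = d * (2 * l + 1)\<close> with \<open>k = d * l\<close>, so the class has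
  \<open>2 * l + 1\<close> points. The parity fixes the sign of each surviving set.\<close>

lemma card_coset:
  assumes "(n - 2 * k) dvd k" and c: "c \<in> {0..<n - 2 * k}"
  shows "odd (card (coset c))"
proof -
  let ?d = "n - 2 * k"
  obtain l where l: "k = ?d * l" using assms by (auto simp: dvd_def)
  have d: "0 < ?d" using k_less by simp
  have "0 \<le> ?d * l" using l k_nonneg by simp
  then have l0: "0 \<le> l" using d by (simp only: zero_le_mult_iff) linarith
  have n: "?d * (2 * l + 1) = n" using l by (simp add: algebra_simps)
  have "card (coset c) = nat (2 * l + 1)"
    using card_residue_class[of c ?d "2 * l + 1"] c l0 unfolding coset_def n by simp
  then show ?thesis using l0 by (simp add: even_nat_iff)
qed

text \<open>Toggling the points of \<open>fr\<close> cancels everything except the cosets: there are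
  \<open>n - 2 * k\<close> of them, each of sign \<open>+1\<close>, or none.\<close>

lemma euler_characteristic:
  "(\<Sum>A | A \<subseteq> {0..<n} \<and> A \<noteq> {} \<and> clique (lift A). (-1) ^ (card A - 1)) =
    (if (n - 2 * k) dvd k then real_of_int (n - 2 * k) else 0)"
proof -
  let ?d = "n - 2 * k"
  let ?F = "{A. A \<subseteq> {0..<n} \<and> A \<noteq> {} \<and> clique (lift A)}"
  define fr where "fr A = {x \<in> {0..<n}. free (lift A) x}" for A
  have fin: "finite ?F" by (rule finite_subset[of _ "Pow {0..<n}"]) auto
  have finA: "finite A" if "A \<in> ?F" for A using that finite_subset[of A "{0..<n}"] by auto
  have ins: "insert x A \<in> ?F \<and> fr (insert x A) = fr A" if A: "A \<in> ?F" and x: "x \<in> fr A" for A x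
  proof -
    have *: "x \<in> {0..<n}" "free (lift A) x" "clique (lift A)" using x A by (auto simp: fr_def)
    show ?thesis using A * clique_insert[OF periodic_lift *(3,2)] free_insert[OF periodic_lift *(3,2)]
      by (auto simp: fr_def lift_insert)
  qed
  have rem: "A - {x} \<in> ?F \<and> fr (A - {x}) = fr A" if A: "A \<in> ?F" and x: "x \<in> fr A" and xA: "x \<in> A" for A x
  proof -
    have *: "x \<in> {0..<n}" "free (lift A) x" using x by (auto simp: fr_def)
    \<comment> \<open>The surviving witness of \<open>x\<close> shows that \<open>A - {x}\<close> is
      nonempty, as membership in \<open>?F\<close> requires.\<close>
    have fr: "free (lift (A - {x})) x" using free_remove[OF *(2)] *(1) by (simp add: lift_remove)
    then have "A - {x} \<noteq> {}" by (auto simp: free_def lift_def)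
    moreover have "clique (lift (A - {x}))" using A unfolding clique_def lift_def by auto
    ultimately have F: "A - {x} \<in> ?F" using A by auto
    moreover have "x \<in> fr (A - {x})" using fr * by (simp add: fr_def)
    \<comment> \<open>Removal inverts the insertion of the free point \<open>x\<close> into
      \<open>A - {x}\<close>, so \<open>ins\<close> gives the invariance of
      \<open>fr\<close>.\<close>
    ultimately have "fr (insert x (A - {x})) = fr (A - {x})" using ins by blast
    then show ?thesis using F xA by (simp add: insert_absorb)
  qed
  have "fr A = {} \<longleftrightarrow> (\<forall>x. \<not> free (lift A) x)" for A
  proof
    assume e: "fr A = {}"
    show "\<forall>x. \<not> free (lift A) x"
    proof (intro allI notI)
      fix x assume "free (lift A) x"
      then have "free (lift A) (x + n * (- (x div n)))" by (rule free_shift[OF periodic_lift])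
      then have "free (lift A) (x mod n)" by (simp add: minus_mult_div_eq_mod[symmetric])
      then have "x mod n \<in> fr A" using n_pos by (simp add: fr_def)
      then show False using e by simp
    qed
  qed (simp add: fr_def)
  moreover have "lift A \<noteq> {}" if "A \<in> ?F" for A using that lift_Int[of A] by auto
  ultimately have fix_iff: "fr A = {} \<longleftrightarrow> (\<exists>c. ?d dvd k \<and> lift A = {z. z mod ?d = c mod ?d})" if "A \<in> ?F" for A
    using that no_free_iff[OF periodic_lift] by simp
  have d: "0 < ?d" using k_less by simp
  have fixed: "{A. A \<in> ?F \<and> fr A = {}} = coset ` {0..<?d}" if dk: "?d dvd k"
  proof (intro set_eqI iffI)
    fix A assume A: "A \<in> {A. A \<in> ?F \<and> fr A = {}}"
    then obtain c where c: "lift A = {z. z mod ?d = c mod ?d}" using fix_iff[of A] by auto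
    then have "A = coset (c mod ?d)" using lift_Int[of A] A by (auto simp: coset_def)
    then show "A \<in> coset ` {0..<?d}" using d by auto
  next
    fix A assume "A \<in> coset ` {0..<?d}"
    then obtain c where c: "c \<in> {0..<?d}" "A = coset c" by blast
    have "?d dvd 2 * k + ?d" using dk by (intro dvd_add dvd_mult) simp_all
    then have "?d dvd n" by simp
    then have L: "lift A = {z. z mod ?d = c mod ?d}"
      using c n_pos by (auto simp: lift_def coset_def mod_mod_cancel)
    have "c \<in> A" using c k_nonneg by (auto simp: coset_def)
    then have "A \<in> ?F" using c L clique_coset[OF dk, of c] by (auto simp: coset_def)
    then show "A \<in> {A. A \<in> ?F \<and> fr A = {}}" using fix_iff[of A] L dk by blast
  qed
  have inj: "inj_on coset {0..<?d}"
  proof (rule inj_onI)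
    fix x y assume xy: "x \<in> {0..<?d}" "y \<in> {0..<?d}" "coset x = coset y"
    have "x \<in> coset x" using xy(1) k_nonneg by (simp add: coset_def)
    then have "x \<in> coset y" using xy by simp
    then show "x = y" using xy(1,2) by (auto simp: coset_def)
  qed
  have "(\<Sum>A\<in>?F. (-1) ^ (card A - 1)) = - (\<Sum>A\<in>?F. (-1::real) ^ card A)"
    by (rule sum_sign_pred_card) (use finA in auto)
  also have "(\<Sum>A\<in>?F. (-1::real) ^ card A) = (\<Sum>A | A \<in> ?F \<and> fr A = {}. (-1) ^ card A)"
    by (rule sum_sign_toggle[OF fin finA]) (use ins rem in \<open>simp_all del: mem_Collect_eq\<close>)
  also have "\<dots> = - (if ?d dvd k then real_of_int ?d else 0)"
  proof (cases "?d dvd k")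
    case True
    have "(\<Sum>A | A \<in> ?F \<and> fr A = {}. (-1::real) ^ card A) = (\<Sum>c\<in>{0..<?d}. (-1) ^ card (coset c))"
      unfolding fixed[OF True] by (simp add: sum.reindex[OF inj])
    also have "\<dots> = (\<Sum>c\<in>{0..<?d}. -1)"
      by (intro sum.cong refl) (simp add: card_coset[OF True])
    finally show ?thesis using True d by simp
  next
    case False
    then have "{A. A \<in> ?F \<and> fr A = {}} = {}" using fix_iff by blast
    then show ?thesis unfolding \<open>{A. A \<in> ?F \<and> fr A = {}} = {}\<close> using False by simp
  qed
  finally show ?thesis by simp
qed

lemma clique_lift_iff:
  assumes A: "A \<subseteq> {0..<n}"
  shows "clique (lift A) \<longleftrightarrow> (\<forall>x\<in>A. \<forall>y\<in>A. min \<bar>x - y\<bar> (n - \<bar>x - y\<bar>) \<le> k)"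
proof
  assume cl: "clique (lift A)"
  show "\<forall>x\<in>A. \<forall>y\<in>A. min \<bar>x - y\<bar> (n - \<bar>x - y\<bar>) \<le> k"
  proof (intro ballI)
    fix x y assume xy: "x \<in> A" "y \<in> A"
    then have "x \<in> lift A" "y \<in> lift A" using A by (auto simp: lift_def subset_iff)
    then have "\<not> (k < y - x \<and> y - x < n - k)" "\<not> (k < x - y \<and> x - y < n - k)"
      using cl unfolding clique_def by blast+
    then show "min \<bar>x - y\<bar> (n - \<bar>x - y\<bar>) \<le> k" using k_nonneg by linarith
  qed
next
  assume le: "\<forall>x\<in>A. \<forall>y\<in>A. min \<bar>x - y\<bar> (n - \<bar>x - y\<bar>) \<le> k"
  show "clique (lift A)"
    unfolding clique_def
  proof (intro ballI notI)
    fix u v assume "u \<in> lift A" "v \<in> lift A" and uv: "k < v - u \<and> v - u < n - k"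
    then have min: "min \<bar>u mod n - v mod n\<bar> (n - \<bar>u mod n - v mod n\<bar>) \<le> k"
      using le by (simp add: lift_def)
    \<comment> \<open>The residues differ by \<open>v - u\<close> itself (\<open>j = 0\<close>) or
      by \<open>v - u - n\<close> (\<open>j = 1\<close>); either way both arguments of
      \<open>min\<close> exceed \<open>k\<close>.\<close>
    define j where "j = v div n - u div n"
    have vu: "v - u = v mod n - u mod n + n * j"
      unfolding j_def right_diff_distrib using mod_mult_div_eq[of u n] mod_mult_div_eq[of v n] by linarith
    have b: "0 \<le> u mod n" "u mod n < n" "0 \<le> v mod n" "v mod n < n" using n_pos by simp_all
    have "n * (-1) < n * j" "n * j < n * 2" using uv vu b k_nonneg by linarith+
    then have "-1 < j" "j < 2" by (simp_all only: mult_less_cancel_left_pos[OF n_pos])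
    then have "j = 0 \<or> j = 1" by auto
    then show False using uv vu min b by auto
  qed
qed

end

section \<open>Diameters of subsets of the circle\<close>

text \<open>The diameter in units of \<open>2 * pi / n\<close>, the step between neighbouring
  points. It is natural-valued in order to index the layers of \<open>sum_layers\<close>.\<close>

definition cyclic_diam :: "nat \<Rightarrow> int set \<Rightarrow> nat" where
  "cyclic_diam n A = nat (Max ((\<lambda>(x, y). min \<bar>x - y\<bar> (int n - \<bar>x - y\<bar>)) ` (A \<times> A)))"

lemma cyclic_diam_le_iff:
  assumes "finite A" "A \<noteq> {}"
  shows "cyclic_diam n A \<le> k \<longleftrightarrow> (\<forall>x\<in>A. \<forall>y\<in>A. min \<bar>x - y\<bar> (int n - \<bar>x - y\<bar>) \<le> int k)"
proof -
  let ?D = "(\<lambda>(x, y). min \<bar>x - y\<bar> (int n - \<bar>x - y\<bar>)) ` (A \<times> A)"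
  have "finite ?D" "?D \<noteq> {}" using assms by auto
  then have "cyclic_diam n A \<le> k \<longleftrightarrow> (\<forall>m\<in>?D. m \<le> int k)"
    unfolding cyclic_diam_def nat_le_iff by (rule Max_le_iff)
  then show ?thesis by simp
qed

text \<open>Rescaling by \<open>2 * pi / n\<close> is monotone, hence commutes with
  \<open>min\<close> and \<open>Max\<close>.\<close>

lemma metric_diam_cyclic:
  assumes n: "1 \<le> n" and A: "A \<subseteq> {0..<int n}" "A \<noteq> {}"
  shows "metric_diam geodesic_dist ((\<lambda>z. 2 * pi * real_of_int z / real n) ` A) =
    2 * pi / real n * real (cyclic_diam n A)"
proof -
  let ?p = "\<lambda>z. 2 * pi * real_of_int z / real n"
  let ?m = "\<lambda>(x, y). min \<bar>x - y\<bar> (int n - \<bar>x - y\<bar>)"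
  let ?h = "\<lambda>z. 2 * pi / real n * real_of_int z"
  have finA: "finite A" using A finite_subset by blast
  have mono: "mono ?h" by (intro monoI mult_left_mono) auto
  have dist: "geodesic_dist (?p x) (?p y) = ?h (?m (x, y))" for x y
  proof -
    have "?p x - ?p y = ?h (x - y)" by (simp add: diff_divide_distrib right_diff_distrib)
    then have "\<bar>?p x - ?p y\<bar> = ?h \<bar>x - y\<bar>" by (simp add: abs_mult)
    moreover have "2 * pi - ?h \<bar>x - y\<bar> = ?h (int n - \<bar>x - y\<bar>)" using n by (simp add: field_simps)
    moreover have "min (?h a) (?h b) = ?h (min a b)" for a b by (rule min_of_mono[OF mono])
    ultimately have "geodesic_dist (?p x) (?p y) = ?h (min \<bar>x - y\<bar> (int n - \<bar>x - y\<bar>))"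
      unfolding geodesic_dist_def by (simp only:)
    then show ?thesis by (simp only: prod.case)
  qed
  have "(\<lambda>(x, y). geodesic_dist x y) ` (?p ` A \<times> ?p ` A) = ?h ` (?m ` (A \<times> A))"
  proof -
    have "?p ` A \<times> ?p ` A = (\<lambda>(x, y). (?p x, ?p y)) ` (A \<times> A)" by auto
    then show ?thesis by (simp only: image_image) (intro image_cong refl, use dist in auto)
  qed
  moreover have "?h (Max (?m ` (A \<times> A))) = Max (?h ` (?m ` (A \<times> A)))"
    by (rule mono_Max_commute[OF mono]) (use finA A in auto)
  \<comment> \<open>This makes the truncation by \<open>nat\<close> in \<open>cyclic_diam\<close>
    harmless.\<close>
  moreover have "0 \<le> Max (?m ` (A \<times> A))"
  proof -
    obtain a where "a \<in> A" using A by blast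
    then have "?m (a, a) \<in> ?m ` (A \<times> A)" by (intro imageI) simp
    then have "?m (a, a) \<le> Max (?m ` (A \<times> A))" using finA by (intro Max_ge) simp_all
    then show ?thesis by simp
  qed
  ultimately show ?thesis unfolding metric_diam_def cyclic_diam_def by simp
qed

section \<open>Exponents and odd divisors\<close>

lemma eta_eq: "eta r = 2 * pi * (real (r div 2) / real r)"
proof -
  have "\<lfloor>real r / 2\<rfloor> = int (r div 2)" using floor_divide_of_nat_eq[of r 2, where 'a = real] by simp
  then show ?thesis by (simp add: eta_def)
qed

text \<open>With \<open>d = n - 2 * k\<close>, the condition \<open>d dvd k\<close> means \<open>n = d * r\<close> with \<open>r\<close> odd.\<close>

lemma odd_divisor_reindex:
  fixes n :: nat and F :: "nat \<Rightarrow> 'b::comm_monoid_add"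
  assumes n: "1 \<le> n"
  shows "(\<Sum>k | k < n div 2 \<and> (n - 2 * k) dvd k. F k) =
    (\<Sum>r | r dvd n \<and> odd r \<and> r \<noteq> n. F (n div r * (r div 2)))"
proof (rule sum.reindex_bij_witness[where i = "\<lambda>r. n div r * (r div 2)" and j = "\<lambda>k. n div (n - 2 * k)"])
  fix k assume k: "k \<in> {k. k < n div 2 \<and> (n - 2 * k) dvd k}"
  define d where "d = n - 2 * k"
  \<comment> \<open>The bound \<open>k < n div 2\<close> gives \<open>d \<ge> 2\<close>; the value
    \<open>d = 1\<close> would correspond to \<open>r = n\<close>, which is excluded.\<close>
  have d2: "2 \<le> d" using k by (auto simp: d_def)
  obtain l where l: "k = d * l" using k unfolding d_def by (auto simp: dvd_def)
  have "n = 2 * k + d" using d2 by (simp add: d_def)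
  then have nd: "n = d * (2 * l + 1)" using l by simp
  have "n div d = 2 * l + 1" unfolding nd using d2 by (intro nonzero_mult_div_cancel_left) simp
  moreover have "n div (2 * l + 1) = d" unfolding nd by (intro nonzero_mult_div_cancel_right) simp
  ultimately have q: "n div (n - 2 * k) = 2 * l + 1" "n div (2 * l + 1) = d" by (simp_all only: d_def)
  show "n div (n div (n - 2 * k)) * (n div (n - 2 * k) div 2) = k"
    unfolding q using l by simp
  show "n div (n - 2 * k) \<in> {r. r dvd n \<and> odd r \<and> r \<noteq> n}"
  proof -
    have "2 * l + 1 dvd n" unfolding nd by (rule dvd_triv_right)
    moreover have "1 * (2 * l + 1) < d * (2 * l + 1)" by (rule mult_less_mono1) (use d2 in simp_all)
    ultimately show ?thesis unfolding q mem_Collect_eq nd[symmetric] by simp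
  qed
  show "F (n div (n div (n - 2 * k)) * (n div (n - 2 * k) div 2)) = F k"
    unfolding q using l by simp
next
  fix r assume r: "r \<in> {r. r dvd n \<and> odd r \<and> r \<noteq> n}"
  then obtain d where nd: "n = r * d" by (auto simp: dvd_def)
  obtain l where rl: "r = 2 * l + 1" using r by (auto elim: oddE)
  have "r \<noteq> 0" using rl by simp
  then have "n div r = d" using nd by simp
  moreover have "r div 2 = l" using rl by simp
  ultimately have q: "n div r * (r div 2) = d * l" by simp
  have "d \<noteq> 0" "d \<noteq> 1" using r n nd by auto
  then have d2: "2 \<le> d" by simp
  have nn: "n = 2 * (d * l) + d" using nd rl by (simp add: algebra_simps)
  then have nk: "n - 2 * (d * l) = d" by simp
  show "n div (n - 2 * (n div r * (r div 2))) = r" unfolding q nk using nd d2 by simp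
  show "n div r * (r div 2) \<in> {k. k < n div 2 \<and> (n - 2 * k) dvd k}"
    unfolding q mem_Collect_eq nk using nn d2 by auto
qed

section \<open>Assembly of the formula\<close>

text \<open>Euler characteristic of a full simplex. A fixed vertex \<open>v\<close> is toggled over
  all of \<open>Pow V\<close>; the empty set takes part in this cancellation, and taking it out
  leaves the value \<open>1\<close>.\<close>

lemma sum_sign_nonempty:
  assumes "finite V" "V \<noteq> {}"
  shows "(\<Sum>A\<in>Pow V - {{}}. (-1::real) ^ (card A - 1)) = 1"
proof -
  obtain v where v: "v \<in> V" using assms by blast
  have "(\<Sum>A\<in>Pow V. (-1::real) ^ card A) = (\<Sum>A | A \<in> Pow V \<and> {v} = {}. (-1) ^ card A)"
    by (rule sum_sign_toggle) (use assms v finite_subset in auto)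
  also have "\<dots> = 0" by simp
  finally have "(\<Sum>A\<in>Pow V - {{}}. (-1::real) ^ card A) = -1"
    using assms by (simp add: sum_diff1)
  moreover have "(\<Sum>A\<in>Pow V - {{}}. (-1::real) ^ (card A - 1)) = - (\<Sum>A\<in>Pow V - {{}}. (-1) ^ card A)"
    by (rule sum_sign_pred_card) (use assms finite_subset in auto)
  ultimately show ?thesis by simp
qed

theorem corollary8p4:
  fixes n :: nat and t :: real
  assumes "n \<ge> 1" and "t > 0"
  shows "rips_magnitude TYPE('k::field) (C_geo n) geodesic_dist t =
    (\<Sum>r\<in>{r. r dvd n \<and> odd r \<and> r \<noteq> n}.
        real n / real r * (exp (- eta r * t) - exp (- eta2 r n * t)))
      + exp (- eta n * t)"
proof -
  let ?p = "\<lambda>z. 2 * pi * real_of_int z / real n"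
  let ?V = "{0..<int n}" and ?M = "n div 2"
  let ?S = "Pow ?V - {{}}"
  define g where "g k = exp (- (2 * pi / real n * real k) * t)" for k
  define s where "s A = (-1::real) ^ (card A - 1)" for A :: "int set"
  have fin: "finite A" if "A \<in> ?S" for A using that finite_subset[of A ?V] by auto
  have finS: "finite ?S" by simp
  have C: "C_geo n = ?p ` ?V"
  proof -
    have "{0..<int n} = int ` {..<n}" by (simp add: image_int_atLeastLessThan lessThan_atLeast0)
    then show ?thesis by (simp add: C_geo_def image_image)
  qed
  then have finC: "finite (C_geo n)" by simp
  have inj: "inj ?p" using assms(1) by (auto simp: inj_def)
  have "rips_magnitude TYPE('k) (C_geo n) geodesic_dist t =
      (\<Sum>B\<in>Pow (C_geo n) - {{}}. (-1) ^ (card B - 1) * exp (- metric_diam geodesic_dist B * t))"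
    by (rule rips_magnitude_eq[OF finC assms(2)])
  also have "\<dots> = (\<Sum>A\<in>?S. s A * g (cyclic_diam n A))"
  proof (rule sum.reindex_cong[where l = "image ?p"])
    show "inj_on (image ?p) ?S" using inj by (simp add: inj_on_def inj_image_eq_iff)
    show "Pow (C_geo n) - {{}} = image ?p ` ?S" unfolding C image_Pow_surj[OF refl, symmetric] by auto
    fix A assume A: "A \<in> ?S"
    have "card (?p ` A) = card A" using inj by (intro card_image inj_on_subset[OF inj]) auto
    then show "(-1) ^ (card (?p ` A) - 1) * exp (- metric_diam geodesic_dist (?p ` A) * t) =
        s A * g (cyclic_diam n A)"
      using metric_diam_cyclic[OF assms(1), of A] A by (simp add: s_def g_def)
  qed
  \<comment> \<open>No cyclic distance exceeds \<open>n div 2\<close>, so all subsets are present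
    there: this top layer is the full simplex and yields the separate term with
    \<open>eta n\<close>.\<close>
  also have "\<dots> = g ?M * sum s ?S +
      (\<Sum>k<?M. (g k - g (Suc k)) * (\<Sum>A | A \<in> ?S \<and> cyclic_diam n A \<le> k. s A))"
  proof (rule sum_layers[OF finS])
    fix A assume A: "A \<in> ?S"
    have "min \<bar>x - y\<bar> (int n - \<bar>x - y\<bar>) \<le> int ?M" for x y :: int by linarith
    then show "cyclic_diam n A \<le> ?M" using A cyclic_diam_le_iff[OF fin[OF A]] by simp
  qed
  also have "sum s ?S = 1"
    unfolding s_def by (rule sum_sign_nonempty) (use assms(1) in auto)
  also have "(\<Sum>k<?M. (g k - g (Suc k)) * (\<Sum>A | A \<in> ?S \<and> cyclic_diam n A \<le> k. s A)) =
      (\<Sum>k<?M. if (n - 2 * k) dvd k then (g k - g (Suc k)) * real (n - 2 * k) else 0)"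
  proof (intro sum.cong refl)
    fix k assume "k \<in> {..<?M}"
    then have kn: "2 * k < n" by simp
    interpret cyclic_rips "int n" "int k" by unfold_locales (use kn in auto)
    have d: "int n - 2 * int k = int (n - 2 * k)" using kn by simp
    have "{A. A \<in> ?S \<and> cyclic_diam n A \<le> k} = {A. A \<subseteq> ?V \<and> A \<noteq> {} \<and> clique (lift A)}"
    proof (intro Collect_cong)
      fix A
      show "A \<in> ?S \<and> cyclic_diam n A \<le> k \<longleftrightarrow> A \<subseteq> ?V \<and> A \<noteq> {} \<and> clique (lift A)"
      proof (cases "A \<in> ?S")
        case True
        then show ?thesis
          using cyclic_diam_le_iff[OF fin[OF True], of n k] clique_lift_iff[of A] by simp
      qed auto
    qed
    then have "(\<Sum>A | A \<in> ?S \<and> cyclic_diam n A \<le> k. s A) = (if (n - 2 * k) dvd k then real (n - 2 * k) else 0)"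
      using euler_characteristic unfolding s_def d of_int_of_nat_eq of_nat_dvd_iff by simp
    then show "(g k - g (Suc k)) * (\<Sum>A | A \<in> ?S \<and> cyclic_diam n A \<le> k. s A) =
        (if (n - 2 * k) dvd k then (g k - g (Suc k)) * real (n - 2 * k) else 0)"
      by simp
  qed
  also have "\<dots> = (\<Sum>k | k < ?M \<and> (n - 2 * k) dvd k. (g k - g (Suc k)) * real (n - 2 * k))"
    by (rule sum.mono_neutral_cong_right) auto
  also have "\<dots> = (\<Sum>r | r dvd n \<and> odd r \<and> r \<noteq> n.
      (g (n div r * (r div 2)) - g (Suc (n div r * (r div 2)))) * real (n - 2 * (n div r * (r div 2))))"
    by (rule odd_divisor_reindex[OF assms(1)])
  also have "\<dots> = (\<Sum>r\<in>{r. r dvd n \<and> odd r \<and> r \<noteq> n}.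
      real n / real r * (exp (- eta r * t) - exp (- eta2 r n * t)))"
  proof (intro sum.cong refl)
    fix r assume r: "r \<in> {r. r dvd n \<and> odd r \<and> r \<noteq> n}"
    then obtain d where nd: "n = r * d" by (auto simp: dvd_def)
    obtain l where rl: "r = 2 * l + 1" using r by (auto elim: oddE)
    have pos: "0 < r" "0 < d" using nd assms(1) by (auto intro: Nat.gr0I)
    have "n div r = d" using nd pos by simp
    moreover have l: "r div 2 = l" using rl by simp
    ultimately have k: "n div r * (r div 2) = d * l" by simp
    have "n - 2 * (d * l) = d" using nd rl by (simp add: algebra_simps)
    then have 1: "real (n - 2 * (d * l)) = real n / real r" using nd pos by simp
    \<comment> \<open>The exponents \<open>eta r\<close> and \<open>eta2 r n\<close> are
      \<open>d * l\<close> and \<open>d * l + 1\<close> steps of length \<open>2 * pi / n\<close>,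
      the two ends of the layer \<open>k = d * l\<close>.\<close>
    have e: "eta r = 2 * pi / real n * real (d * l)"
      unfolding eta_eq l using nd pos by simp
    have "eta2 r n = 2 * pi / real n + eta r" by (simp add: eta2_def eta_def distrib_left)
    then have e2: "eta2 r n = 2 * pi / real n * real (Suc (d * l))" by (simp add: e algebra_simps add_divide_distrib)
    show "(g (n div r * (r div 2)) - g (Suc (n div r * (r div 2)))) * real (n - 2 * (n div r * (r div 2))) =
        real n / real r * (exp (- eta r * t) - exp (- eta2 r n * t))"
      unfolding k 1 g_def e e2 by (rule mult.commute)
  qed
  also have "g ?M = exp (- eta n * t)" by (simp add: g_def eta_eq)
  finally show ?thesis by simp
qed

end
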